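(* Let $K$ be a field of characteristic $p>0$ and $R=K[x_0,\dots,x_n]$ with homogeneous maximal ideal $\mathfrak{m}$. Let $f\in R$ be a homogeneous polynomial of degree $d$ whose Jacobian ideal $(\partial f/\partial x_0,\dots,\partial f/\partial x_n)$ is $\mathfrak{m}$-primary. If $p\geqslant nd-d-n$, then the Frobenius action \[F\colon[H^n_\mathfrak{m}(R/fR)]_{<0}\longrightarrow[H^n_\mathfrak{m}(R/fR)]_{<0}\] is injective.
   Context: $H^n_\mathfrak{m}(R/fR)$ is the $n$-th local cohomology module with its natural $\mathbf{Z}$-grading; $[\,\cdot\,]_{<0}$ denotes the sum of its negatively graded components. $F$ is the map on local cohomology induced by the Frobenius endomorphism $r\mapsto r^p$ of $R/fR$; it sends the degree $j$ component to the degree $pj$ component. *)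

theory Defs
  imports Main "HOL-Library.Poly_Mapping"
begin

text \<open>Polynomials in variables x_0, x_1, ... with coefficients in 'a, as finitely
supported functions from monomials (exponent vectors) to coefficients.
The ring R = K[x_0,...,x_n] is the subring of those polynomials that only
involve the variables x_0,...,x_n.\<close>

type_synonym 'a mpoly = "(nat \<Rightarrow>\<^sub>0 nat) \<Rightarrow>\<^sub>0 'a"

definition var :: "nat \<Rightarrow> 'a::comm_ring_1 mpoly" where
  "var i = Poly_Mapping.single (Poly_Mapping.single i 1) 1"

definition in_R :: "nat \<Rightarrow> 'a::zero mpoly \<Rightarrow> bool" where
  "in_R n q \<longleftrightarrow> (\<forall>m\<in>Poly_Mapping.keys q. Poly_Mapping.keys m \<subseteq> {0..n})"

definition tdeg :: "(nat \<Rightarrow>\<^sub>0 nat) \<Rightarrow> nat" where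
  "tdeg m = (\<Sum>i\<in>Poly_Mapping.keys m. Poly_Mapping.lookup m i)"

definition homogeneous :: "nat \<Rightarrow> 'a::zero mpoly \<Rightarrow> bool" where
  "homogeneous d q \<longleftrightarrow> (\<forall>m\<in>Poly_Mapping.keys q. tdeg m = d)"

definition pd :: "nat \<Rightarrow> 'a::comm_ring_1 mpoly \<Rightarrow> 'a mpoly" where
  "pd i q = (\<Sum>m\<in>Poly_Mapping.keys q. Poly_Mapping.single (m - Poly_Mapping.single i 1)
                              (of_nat (Poly_Mapping.lookup m i) * Poly_Mapping.lookup q m))"

text \<open>The Jacobian ideal (pd 0 f, ..., pd n f) of R is m-primary, m = (x_0,...,x_n):
its radical is m, i.e. it is contained in m (generators have zero constant term)
and some power of every variable lies in it.\<close>
definition jacobian_m_primary :: "nat \<Rightarrow> 'a::comm_ring_1 mpoly \<Rightarrow> bool" where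
  "jacobian_m_primary n f \<longleftrightarrow>
     (\<forall>j\<le>n. Poly_Mapping.lookup (pd j f) 0 = 0) \<and>
     (\<exists>N. \<forall>i\<le>n. \<exists>h. (\<forall>j\<le>n. in_R n (h j)) \<and> var i ^ N = (\<Sum>j\<le>n. h j * pd j f))"

definition X :: "nat set \<Rightarrow> 'a::comm_ring_1 mpoly" where
  "X S = (\<Prod>i\<in>S. var i)"

text \<open>Cech complex of M = R/fR on x_0,...,x_n: C^t = (+)_{|S|=t} M_{X_S}.
A cochain with common exponent k is given by numerators g, its S-component
being g S / X_S^k. The T-component of its Cech differential is
cech_num k g T / X_T^k.\<close>
definition cech_num :: "nat \<Rightarrow> (nat set \<Rightarrow> 'a::comm_ring_1 mpoly) \<Rightarrow> nat set \<Rightarrow> 'a mpoly" where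
  "cech_num k g T = (\<Sum>i\<in>T. (-1) ^ card {j\<in>T. j < i} * g (T - {i}) * var i ^ k)"

text \<open>a / X_T^k is zero in the localization (R/fR)_{X_T}.\<close>
definition loc_zero :: "nat \<Rightarrow> 'a::comm_ring_1 mpoly \<Rightarrow> nat set \<Rightarrow> 'a mpoly \<Rightarrow> bool" where
  "loc_zero n f T a \<longleftrightarrow> (\<exists>e q. in_R n q \<and> X T ^ e * a = q * f)"

abbreviation Sn :: "nat \<Rightarrow> nat \<Rightarrow> nat set" where
  "Sn n i \<equiv> {0..n} - {i}"

text \<open>An element of C^n = (+)_{i} (R/fR)_{X/x_i} given by numerators g (S_i-component
g(S_i)/X_{S_i}^k) with entries in R.\<close>
definition cochain_n :: "nat \<Rightarrow> nat \<Rightarrow> (nat set \<Rightarrow> 'a::comm_ring_1 mpoly) \<Rightarrow> bool" where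
  "cochain_n n k g \<longleftrightarrow> (\<forall>i\<le>n. in_R n (g (Sn n i)))"

definition cocycle_n :: "nat \<Rightarrow> 'a::comm_ring_1 mpoly \<Rightarrow> nat \<Rightarrow> (nat set \<Rightarrow> 'a mpoly) \<Rightarrow> bool" where
  "cocycle_n n f k g \<longleftrightarrow> loc_zero n f {0..n} (cech_num k g {0..n})"

text \<open>Its class in H^n_m(R/fR) is zero: it is the differential of some cochain in
C^{n-1} (components h U / X_U^m, common exponent m >= k).\<close>
definition class_zero_n :: "nat \<Rightarrow> 'a::comm_ring_1 mpoly \<Rightarrow> nat \<Rightarrow> (nat set \<Rightarrow> 'a mpoly) \<Rightarrow> bool" where
  "class_zero_n n f k g \<longleftrightarrow>
     (\<exists>m\<ge>k. \<exists>h. (\<forall>U. in_R n (h U)) \<and>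
        (\<forall>i\<le>n. loc_zero n f (Sn n i)
            (g (Sn n i) * X (Sn n i) ^ (m - k) - cech_num m h (Sn n i))))"

text \<open>The cochain lies in negative degrees: every component g(S_i)/X_{S_i}^k only
involves terms of degree (total degree of the numerator monomial) - k n < 0.\<close>
definition negative_n :: "nat \<Rightarrow> nat \<Rightarrow> (nat set \<Rightarrow> 'a::zero mpoly) \<Rightarrow> bool" where
  "negative_n n k g \<longleftrightarrow> (\<forall>i\<le>n. \<forall>m\<in>Poly_Mapping.keys (g (Sn n i)). tdeg m < k * n)"

end

theory Submission
  imports Defs "HOL.Modules" "HOL-Computational_Algebra.Primes" "HOL-Library.Product_Lexorder"
begin

text \<open>
  The connecting map of 0 \<rightarrow> R(-d) \<rightarrow> R \<rightarrow> R/fR \<rightarrow> 0 embeds \<open>H\<^sup>n(R/fR)\<close> into \<open>H\<^sup>n\<^sup>+\<^sup>1(R)(-d)\<close>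
  and turns Frobenius into \<open>f\<^sup>p\<^sup>-\<^sup>1 F\<close>. A class there is a fraction \<open>q / (x\<^sub>0 \<cdots> x\<^sub>n)\<^sup>K\<close>, and it vanishes
  iff \<open>q \<in> (x\<^sub>0\<^sup>K, \<dots>, x\<^sub>n\<^sup>K)\<close>. Suppose that \<open>f\<^sup>p\<^sup>-\<^sup>1 q\<^sup>p\<close> lies in \<open>(x\<^sub>i\<^sup>p\<^sup>K)\<close> and q does not lie in
  \<open>(x\<^sub>i\<^sup>K)\<close>. Let \<open>u = f\<^sup>t q\<^sup>p\<close> be the last product outside \<open>(x\<^sub>i\<^sup>p\<^sup>K)\<close>; then \<open>t \<le> p - 2\<close>. Partial
  derivatives preserve \<open>(x\<^sub>i\<^sup>p\<^sup>K)\<close> in characteristic p, so differentiating \<open>f\<^sup>t\<^sup>+\<^sup>1 q\<^sup>p\<close> shows that the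
  Jacobian ideal multiplies u into \<open>(x\<^sub>i\<^sup>p\<^sup>K)\<close>. By Macaulay's bound, a nonzero class annihilated by
  an \<open>m\<close>-primary ideal with n + 1 generators of degree d - 1 has degree at least -(n + 1)(d - 1),
  whereas the class of u has degree at most -2d - p.

  Macaulay's bound is obtained from the Koszul complex on \<open>x\<^sub>i\<^sup>N\<close> and the partial derivatives
  \<open>f\<^sub>j\<close> together. Cohomology in degrees up to n vanishes for \<open>x\<^sub>i\<^sup>N\<close>, hence for the joint sequence,
  hence for \<open>f\<^sub>j\<close> alone because \<open>x\<^sub>i\<^sup>N \<in> (f\<^sub>j)\<close>. Consequently \<open>H\<^sup>n\<^sup>+\<^sup>1\<close> of the joint complex embeds
  both into \<open>R/(x\<^sub>i\<^sup>N)\<close>, where its image is the annihilator of the \<open>f\<^sub>j\<close>, and into \<open>R/(f\<^sub>j)\<close>, which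
  has no elements of negative degree.
\<close>

section \<open>Ideals\<close>

global_interpretation ideal: module "(*) :: 'r::comm_ring_1 \<Rightarrow> 'r \<Rightarrow> 'r"
  by unfold_locales (simp_all add: algebra_simps)

\<comment> \<open>For this scaling it is associativity read from right to left, which loops with \<open>algebra_simps\<close>.\<close>
declare ideal.scale_scale [simp del]

lemma unit_mult_in_span_iff:
  fixes c x :: "'r::comm_ring_1"
  assumes "c dvd 1"
  shows "c * x \<in> ideal.span S \<longleftrightarrow> x \<in> ideal.span S"
proof
  assume "c * x \<in> ideal.span S"
  moreover obtain c' where "c' * c = 1" using assms by (metis dvdE mult.commute)
  ultimately show "x \<in> ideal.span S"
    using ideal.span_scale[of "c * x" S c'] by (simp flip: mult.assoc)
qed (rule ideal.span_scale)

section \<open>Koszul cochains\<close>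

definition koszul_sign :: "'i::linorder \<Rightarrow> 'i set \<Rightarrow> 'r::comm_ring_1" where
  "koszul_sign i T = (-1) ^ card {j\<in>T. j < i}"

definition koszul :: "('i::linorder \<Rightarrow> 'r::comm_ring_1) \<Rightarrow> ('i set \<Rightarrow> 'r) \<Rightarrow> 'i set \<Rightarrow> 'r" where
  "koszul a c T = (\<Sum>i\<in>T. koszul_sign i T * a i * c (T - {i}))"

text \<open>
  A cochain c on \<open>insert l I\<close> is the pair of its restriction to I and \<open>slice l c\<close>; \<open>glue\<close> is the
  inverse. With this choice of signs the differential of (z, w) is (dz, \<open>a\<^sub>l\<close> z - dw).
\<close>
definition slice :: "'i::linorder \<Rightarrow> ('i set \<Rightarrow> 'r::comm_ring_1) \<Rightarrow> 'i set \<Rightarrow> 'r" where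
  "slice l c S = koszul_sign l S * c (insert l S)"

definition glue :: "'i::linorder \<Rightarrow> ('i set \<Rightarrow> 'r::comm_ring_1) \<Rightarrow> ('i set \<Rightarrow> 'r) \<Rightarrow> 'i set \<Rightarrow> 'r" where
  "glue l z w T = (if l \<in> T then koszul_sign l (T - {l}) * w (T - {l}) else z T)"

lemma koszul_sign_cases: "koszul_sign i T = (1 :: 'r::comm_ring_1) \<or> koszul_sign i T = (-1 :: 'r)"
  by (simp add: koszul_sign_def uminus_power_if)

lemma koszul_sign_mult_self [simp]: "koszul_sign i T * koszul_sign i T = 1"
  by (simp add: koszul_sign_def flip: power_add mult_2)

lemma koszul_sign_mult_self_left [simp]: "koszul_sign i T * (koszul_sign i T * x) = x"
  by (simp flip: mult.assoc)

lemma koszul_sign_insert_self [simp]: "koszul_sign i (insert i T) = koszul_sign i T"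
proof -
  have "{j\<in>insert i T. j < i} = {j\<in>T. j < i}" by auto
  then show ?thesis by (simp add: koszul_sign_def)
qed

lemma koszul_sign_insert:
  assumes "finite T" "l \<notin> T" "i \<in> T"
  shows "koszul_sign i (insert l T)
    = - (koszul_sign l T * koszul_sign i T * koszul_sign l (T - {i}) :: 'r::comm_ring_1)"
proof (cases "l < i")
  case True
  then have "{j\<in>insert l T. j < i} = insert l {j\<in>T. j < i}" "{j\<in>T - {i}. j < l} = {j\<in>T. j < l}"
    by auto
  then have "koszul_sign i (insert l T) = (- koszul_sign i T :: 'r)"
    "koszul_sign l (T - {i}) = (koszul_sign l T :: 'r)"
    using assms by (simp_all add: koszul_sign_def)
  then show ?thesis by (simp add: mult_ac)
next
  case False
  then have "i < l" using assms by (metis linorder_neqE)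
  then have "{j\<in>T. j < l} = insert i {j\<in>T - {i}. j < l}" "{j\<in>insert l T. j < i} = {j\<in>T. j < i}"
    using assms by auto
  then have "koszul_sign l T = (- koszul_sign l (T - {i}) :: 'r)"
    "koszul_sign i (insert l T) = (koszul_sign i T :: 'r)"
    using assms by (simp_all add: koszul_sign_def)
  then show ?thesis by (simp add: mult_ac)
qed

lemma koszul_cong:
  "(\<And>i. i \<in> T \<Longrightarrow> c (T - {i}) = c' (T - {i})) \<Longrightarrow> koszul a c T = koszul a c' T"
  by (simp add: koszul_def)

lemma koszul_zero [simp]: "koszul a (\<lambda>S. 0) T = 0"
  by (simp add: koszul_def)

lemma koszul_add: "koszul a (\<lambda>S. c S + c' S) T = koszul a c T + koszul a c' T"
  by (simp add: koszul_def algebra_simps sum.distrib)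

lemma koszul_diff: "koszul a (\<lambda>S. c S - c' S) T = koszul a c T - koszul a c' T"
  by (simp add: koszul_def algebra_simps sum_subtractf)

lemma koszul_mult: "koszul a (\<lambda>S. r * c S) T = r * koszul a c T"
  by (simp add: koszul_def sum_distrib_left algebra_simps)

lemma koszul_insert:
  assumes "finite T" "l \<notin> T"
  shows "koszul a c (insert l T) = koszul_sign l T * (a l * c T - koszul a (slice l c) T)"
proof -
  have summand: "koszul_sign i (insert l T) * a i * c (insert l T - {i})
      = - (koszul_sign l T * (koszul_sign i T * a i * slice l c (T - {i})))" if "i \<in> T" for i
  proof -
    have "insert l T - {i} = insert l (T - {i})" using that assms by auto
    then show ?thesis
      by (simp add: koszul_sign_insert[OF assms that] slice_def algebra_simps)
  qed
  have "koszul a c (insert l T) = koszul_sign l T * a l * c T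
      + (\<Sum>i\<in>T. koszul_sign i (insert l T) * a i * c (insert l T - {i}))"
    using assms by (simp add: koszul_def)
  also have "(\<Sum>i\<in>T. koszul_sign i (insert l T) * a i * c (insert l T - {i}))
      = - (koszul_sign l T * koszul a (slice l c) T)"
    unfolding koszul_def sum_distrib_left sum_negf[symmetric] by (intro sum.cong refl summand)
  finally show ?thesis by (simp add: algebra_simps)
qed

lemma koszul_koszul: "finite T \<Longrightarrow> koszul a (koszul a b) T = 0"
proof (induction T arbitrary: b rule: finite_induct)
  case empty
  then show ?case by (simp add: koszul_def)
next
  case (insert l T)
  have "koszul a (slice l (koszul a b)) T = koszul a (\<lambda>S. a l * b S - koszul a (slice l b) S) T"
  proof (rule koszul_cong)
    fix i
    have "finite (T - {i})" "l \<notin> T - {i}" using insert by auto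
    then show "slice l (koszul a b) (T - {i}) = a l * b (T - {i}) - koszul a (slice l b) (T - {i})"
      by (simp add: slice_def koszul_insert)
  qed
  also have "\<dots> = a l * koszul a b T"
    by (simp add: koszul_diff koszul_mult insert.IH)
  finally show ?case using insert.hyps by (simp add: koszul_insert)
qed

lemma slice_glue: "l \<notin> S \<Longrightarrow> slice l (glue l z w) S = w S"
  by (simp add: slice_def glue_def)

lemma koszul_glue: "l \<notin> T \<Longrightarrow> koszul a (glue l z w) T = koszul a z T"
  by (rule koszul_cong) (simp add: glue_def)

lemma koszul_slice_glue: "l \<notin> T \<Longrightarrow> koszul a (slice l (glue l z w)) T = koszul a w T"
  by (rule koszul_cong) (simp add: slice_glue)

lemma koszul_power_CHAR:
  fixes a :: "'i::linorder \<Rightarrow> 'r::comm_ring_1"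
  assumes "prime CHAR('r)"
  shows "koszul (\<lambda>i. a i ^ CHAR('r)) (\<lambda>S. c S ^ CHAR('r)) T = koszul a c T ^ CHAR('r)"
proof -
  have "(- 1 :: 'r) ^ CHAR('r) = - 1"
    using minus_power_prime_CHAR[OF refl assms, of 1] by simp
  then have "koszul_sign i T ^ CHAR('r) = (koszul_sign i T :: 'r)" for i
    using koszul_sign_cases[of i T, where 'r = 'r] by auto
  then show ?thesis
    unfolding koszul_def freshmans_dream_sum[OF assms refl] by (simp add: power_mult_distrib)
qed

lemma koszul_in_span: "koszul a b T \<in> ideal.span (a ` T)"
  unfolding koszul_def
proof (rule ideal.span_sum)
  fix i assume "i \<in> T"
  then have "koszul_sign i T * b (T - {i}) * a i \<in> ideal.span (a ` T)"
    by (intro ideal.span_scale ideal.span_base) simp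
  then show "koszul_sign i T * a i * b (T - {i}) \<in> ideal.span (a ` T)" by (simp add: mult_ac)
qed

lemma in_span_image_iff_koszul:
  fixes a :: "'i::linorder \<Rightarrow> 'r::comm_ring_1"
  assumes "finite T"
  shows "u \<in> ideal.span (a ` T) \<longleftrightarrow> (\<exists>b. u = koszul a b T)"
proof
  assume "u \<in> ideal.span (a ` T)"
  then show "\<exists>b. u = koszul a b T"
  proof (induction rule: ideal.span_induct_alt)
    case base
    then show ?case by (intro exI[of _ "\<lambda>S. 0"]) simp
  next
    case (step r x y)
    then obtain i b where "i \<in> T" and x: "x = a i" and y: "y = koszul a b T" by blast
    define \<delta> :: "'i set \<Rightarrow> 'r" where "\<delta> S = (if S = T - {i} then koszul_sign i T else 0)" for S
    have "koszul a \<delta> T = (\<Sum>j\<in>T. if j = i then a i else 0)"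
      unfolding koszul_def \<delta>_def using \<open>i \<in> T\<close> by (intro sum.cong) (auto simp: mult_ac)
    also have "\<dots> = x" using assms \<open>i \<in> T\<close> x by simp
    finally have "r * x + y = koszul a (\<lambda>S. r * \<delta> S + b S) T"
      by (simp add: koszul_add koszul_mult y)
    then show ?case by blast
  qed
qed (auto simp: koszul_in_span)

section \<open>Exactness of Koszul complexes\<close>

text \<open>
  Only the values of c on subsets of I of the relevant size matter, so no support condition is
  imposed.
\<close>
definition koszul_cocycle ::
    "('i::linorder \<Rightarrow> 'r::comm_ring_1) \<Rightarrow> 'i set \<Rightarrow> nat \<Rightarrow> ('i set \<Rightarrow> 'r) \<Rightarrow> bool" where
  "koszul_cocycle a I i c \<longleftrightarrow> (\<forall>T\<subseteq>I. card T = Suc i \<longrightarrow> koszul a c T = 0)"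

definition koszul_coboundary ::
    "('i::linorder \<Rightarrow> 'r::comm_ring_1) \<Rightarrow> 'i set \<Rightarrow> nat \<Rightarrow> ('i set \<Rightarrow> 'r) \<Rightarrow> bool" where
  "koszul_coboundary a I i c \<longleftrightarrow> (\<exists>b. \<forall>T\<subseteq>I. card T = i \<longrightarrow> c T = koszul a b T)"

definition koszul_exact :: "('i::linorder \<Rightarrow> 'r::comm_ring_1) \<Rightarrow> 'i set \<Rightarrow> nat \<Rightarrow> bool" where
  "koszul_exact a I i \<longleftrightarrow> (\<forall>c. koszul_cocycle a I i c \<longrightarrow> koszul_coboundary a I i c)"

definition koszul_exact_below :: "('i::linorder \<Rightarrow> 'r::comm_ring_1) \<Rightarrow> 'i set \<Rightarrow> nat \<Rightarrow> bool" where
  "koszul_exact_below a I r \<longleftrightarrow> (\<forall>i<r. koszul_exact a I i)"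

lemma koszul_cocycle_mult: "koszul_cocycle a I i c \<Longrightarrow> koszul_cocycle a I i (\<lambda>T. r * c T)"
  by (simp add: koszul_cocycle_def koszul_mult)

lemma koszul_coboundary_add:
  assumes "koszul_coboundary a I i c" "koszul_coboundary a I i c'"
  shows "koszul_coboundary a I i (\<lambda>T. c T + c' T)"
proof -
  obtain b b' where "\<forall>T\<subseteq>I. card T = i \<longrightarrow> c T = koszul a b T"
    "\<forall>T\<subseteq>I. card T = i \<longrightarrow> c' T = koszul a b' T"
    using assms by (auto simp: koszul_coboundary_def)
  then show ?thesis
    unfolding koszul_coboundary_def
    by (intro exI[of _ "\<lambda>S. b S + b' S"]) (simp add: koszul_add)
qed

lemma koszul_coboundary_mult:
  assumes "koszul_coboundary a I i c"
  shows "koszul_coboundary a I i (\<lambda>T. r * c T)"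
proof -
  obtain b where "\<forall>T\<subseteq>I. card T = i \<longrightarrow> c T = koszul a b T"
    using assms by (auto simp: koszul_coboundary_def)
  then show ?thesis
    unfolding koszul_coboundary_def by (intro exI[of _ "\<lambda>S. r * b S"]) (simp add: koszul_mult)
qed

lemma koszul_coboundary_cong:
  "(\<And>T. T \<subseteq> I \<Longrightarrow> card T = i \<Longrightarrow> c T = c' T) \<Longrightarrow>
    koszul_coboundary a I i c \<longleftrightarrow> koszul_coboundary a I i c'"
  by (simp add: koszul_coboundary_def cong: conj_cong imp_cong)

lemma koszul_coboundary_subset:
  "koszul_coboundary a I i c \<Longrightarrow> I' \<subseteq> I \<Longrightarrow> koszul_coboundary a I' i c"
  unfolding koszul_coboundary_def by (meson subset_trans)

lemma koszul_cocycle_top: "finite I \<Longrightarrow> koszul_cocycle a I (card I) c"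
  unfolding koszul_cocycle_def by (metis card_mono not_less_eq_eq order_refl)

lemma koszul_coboundary_top_iff:
  assumes "finite I"
  shows "koszul_coboundary a I (card I) c \<longleftrightarrow> c I \<in> ideal.span (a ` I)"
proof -
  have "T \<subseteq> I \<and> card T = card I \<longleftrightarrow> T = I" for T
    using assms card_subset_eq by blast
  then have "koszul_coboundary a I (card I) c \<longleftrightarrow> (\<exists>b. c I = koszul a b I)"
    unfolding koszul_coboundary_def by metis
  then show ?thesis by (simp add: in_span_image_iff_koszul[OF assms])
qed

lemma subset_insert_cases:
  assumes "T \<subseteq> insert l I" "l \<notin> I" "finite I"
  obtains (avoiding) "T \<subseteq> I" "l \<notin> T"
  | (containing) S where "T = insert l S" "S \<subseteq> I" "l \<notin> S" "finite S" "card T = Suc (card S)"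
proof (cases "l \<in> T")
  case True
  define S where "S = T - {l}"
  have "T = insert l S" "S \<subseteq> I" "l \<notin> S" using True assms by (auto simp: S_def)
  moreover have "finite S" using \<open>S \<subseteq> I\<close> assms(3) by (rule finite_subset)
  ultimately show ?thesis using that(2) by simp
next
  case False
  with assms that(1) show ?thesis by blast
qed

lemma koszul_cocycle_insert_iff:
  assumes "finite I" "l \<notin> I"
  shows "koszul_cocycle a (insert l I) i c \<longleftrightarrow>
    koszul_cocycle a I i c \<and> (\<forall>T\<subseteq>I. card T = i \<longrightarrow> a l * c T = koszul a (slice l c) T)"
proof (intro iffI conjI allI impI)
  assume cocycle: "koszul_cocycle a (insert l I) i c"
  then show "koszul_cocycle a I i c" by (auto simp: koszul_cocycle_def)
  fix T assume subset: "T \<subseteq> I" "card T = i"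
  then have "finite T" "l \<notin> T" using assms by (auto intro: finite_subset)
  moreover from this have "koszul a c (insert l T) = 0"
    using cocycle subset unfolding koszul_cocycle_def by (metis card_insert_disjoint insert_mono)
  ultimately have "koszul_sign l T * (koszul_sign l T * (a l * c T - koszul a (slice l c) T)) = 0"
    by (simp add: koszul_insert)
  then show "a l * c T = koszul a (slice l c) T" by simp
next
  assume cocycle: "koszul_cocycle a I i c \<and>
    (\<forall>T\<subseteq>I. card T = i \<longrightarrow> a l * c T = koszul a (slice l c) T)"
  show "koszul_cocycle a (insert l I) i c"
    unfolding koszul_cocycle_def
  proof (intro allI impI)
    fix T assume "T \<subseteq> insert l I" and card: "card T = Suc i"
    from this(1) assms(2,1) show "koszul a c T = 0"
    proof (cases rule: subset_insert_cases)
      case avoiding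
      with cocycle card show ?thesis by (simp add: koszul_cocycle_def)
    next
      case (containing S)
      with cocycle card show ?thesis by (simp add: koszul_insert)
    qed
  qed
qed

lemma koszul_coboundary_insertI:
  assumes "finite I" "l \<notin> I"
    and restriction: "\<And>T. T \<subseteq> I \<Longrightarrow> card T = i \<Longrightarrow> c T = koszul a z T"
    and slice: "\<And>T. T \<subseteq> I \<Longrightarrow> Suc (card T) = i \<Longrightarrow> slice l c T = a l * z T - koszul a w T"
  shows "koszul_coboundary a (insert l I) i c"
proof -
  have "c T = koszul a (glue l z w) T" if "T \<subseteq> insert l I" and card: "card T = i" for T
    using that(1) assms(2,1)
  proof (cases rule: subset_insert_cases)
    case avoiding
    with restriction card show ?thesis by (simp add: koszul_glue)
  next
    case (containing S)
    have "koszul a (glue l z w) T = koszul_sign l S * (a l * z S - koszul a w S)"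
      using containing by (simp add: koszul_insert koszul_slice_glue) (simp add: glue_def)
    also have "\<dots> = koszul_sign l S * slice l c S" using slice[of S] containing card by simp
    also have "\<dots> = c T" using containing by (simp add: slice_def)
    finally show ?thesis by simp
  qed
  then show ?thesis by (auto simp: koszul_coboundary_def)
qed

lemma koszul_coboundary_insert:
  assumes "finite I" "l \<notin> I" and exact: "koszul_exact_below a I i"
    and cocycle: "koszul_cocycle a (insert l I) i c" and coboundary: "koszul_coboundary a I i c"
  shows "koszul_coboundary a (insert l I) i c"
proof -
  obtain b where restriction: "\<And>T. T \<subseteq> I \<Longrightarrow> card T = i \<Longrightarrow> c T = koszul a b T"
    using coboundary by (auto simp: koszul_coboundary_def)
  define defect where "defect = (\<lambda>S. a l * b S - slice l c S)"
  have "\<exists>w. \<forall>T\<subseteq>I. Suc (card T) = i \<longrightarrow> defect T = koszul a w T"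
  proof (cases i)
    case (Suc j)
    have "koszul_cocycle a I j defect"
      using iffD1[OF koszul_cocycle_insert_iff[OF assms(1,2)] cocycle] restriction
      by (simp add: koszul_cocycle_def defect_def koszul_diff koszul_mult Suc)
    then have "koszul_coboundary a I j defect"
      using exact by (simp add: koszul_exact_below_def koszul_exact_def Suc)
    then show ?thesis by (simp add: koszul_coboundary_def Suc)
  qed simp
  then obtain w where slice: "\<And>T. T \<subseteq> I \<Longrightarrow> Suc (card T) = i \<Longrightarrow> defect T = koszul a w T"
    by blast
  show ?thesis
  proof (rule koszul_coboundary_insertI[OF assms(1,2) restriction])
    fix T assume "T \<subseteq> I" "Suc (card T) = i"
    from slice[OF this] show "slice l c T = a l * b T - koszul a w T"
      by (simp add: defect_def algebra_simps)
  qed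
qed

lemma koszul_exact_below_insert:
  assumes "finite I" "l \<notin> I" "koszul_exact_below a I r"
  shows "koszul_exact_below a (insert l I) r"
  unfolding koszul_exact_below_def koszul_exact_def
proof (intro allI impI)
  fix i c assume "i < r" and cocycle: "koszul_cocycle a (insert l I) i c"
  then have "koszul_coboundary a I i c"
    using assms by (simp add: koszul_cocycle_insert_iff koszul_exact_below_def koszul_exact_def)
  moreover have "koszul_exact_below a I i"
    using \<open>i < r\<close> assms(3) by (simp add: koszul_exact_below_def)
  ultimately show "koszul_coboundary a (insert l I) i c"
    using assms cocycle by (intro koszul_coboundary_insert)
qed

lemma finite_superset_induct [consumes 2, case_names base insert]:
  assumes "finite J" "I \<subseteq> J" and "P I"
    and step: "\<And>l K. finite K \<Longrightarrow> I \<subseteq> K \<Longrightarrow> insert l K \<subseteq> J \<Longrightarrow> l \<notin> K \<Longrightarrow> P K \<Longrightarrow> P (insert l K)"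
  shows "P J"
proof -
  have "finite (J - I)" "finite I" using assms(1,2) by (auto intro: finite_subset)
  from this(1) subset_refl have "P (I \<union> (J - I))"
  proof (induction rule: finite_subset_induct')
    case (insert l F)
    then show ?case
      using assms(2) \<open>finite I\<close> step[of "I \<union> F" l] by auto
  qed (simp add: \<open>P I\<close>)
  then show ?thesis using assms(2) by (simp add: Un_absorb1)
qed

lemma koszul_exact_below_superset:
  assumes "finite J" "I \<subseteq> J" "koszul_exact_below a I r"
  shows "koszul_exact_below a J r"
  using assms(1,2)
  by (induction rule: finite_superset_induct) (auto intro: koszul_exact_below_insert assms(3))

lemma koszul_coboundary_superset:
  assumes "finite J" "I \<subseteq> J" and exact: "koszul_exact_below a I i"
    and "koszul_cocycle a J i c" "koszul_coboundary a I i c"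
  shows "koszul_coboundary a J i c"
proof -
  have "koszul_cocycle a J i c \<longrightarrow> koszul_coboundary a J i c"
    using assms(1,2)
  proof (induction rule: finite_superset_induct)
    case (insert l K)
    have "koszul_exact_below a K i" using insert(1,2) exact by (rule koszul_exact_below_superset)
    with insert show ?case by (simp add: koszul_cocycle_insert_iff koszul_coboundary_insert)
  qed (simp add: assms(5))
  with assms(4) show ?thesis by blast
qed

lemma koszul_coboundary_generator_mult:
  assumes "finite I" "l \<in> I" "koszul_cocycle a I i c"
  shows "koszul_coboundary a I i (\<lambda>T. a l * c T)"
proof -
  have "koszul_coboundary a (insert l (I - {l})) i (\<lambda>T. a l * c T)"
  proof (rule koszul_coboundary_insertI[where z = "slice l c" and w = "\<lambda>S. 0"])
    fix T assume "T \<subseteq> I - {l}" "card T = i"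
    then show "a l * c T = koszul a (slice l c) T"
      using assms koszul_cocycle_insert_iff[of "I - {l}" l a i c] by (simp add: insert_absorb)
  qed (use assms in \<open>simp_all add: slice_def mult_ac\<close>)
  then show ?thesis using assms(2) by (simp add: insert_absorb)
qed

lemma koszul_coboundary_ideal_mult:
  assumes "finite I" "koszul_cocycle a I i c" "r \<in> ideal.span (a ` I)"
  shows "koszul_coboundary a I i (\<lambda>T. r * c T)"
  using assms(3)
proof (induction rule: ideal.span_induct_alt)
  case base
  show ?case unfolding koszul_coboundary_def by (intro exI[of _ "\<lambda>S. 0"]) simp
next
  case (step s x y)
  then have "koszul_coboundary a I i (\<lambda>T. x * c T)"
    using assms by (auto intro: koszul_coboundary_generator_mult)
  from koszul_coboundary_add[OF koszul_coboundary_mult[OF this, of s] step.IH]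
  show ?case by (simp add: algebra_simps)
qed

lemma koszul_cocycle_glue:
  assumes "finite I" "l \<notin> I" "koszul_cocycle a I i z"
    and "\<And>T. T \<subseteq> I \<Longrightarrow> card T = i \<Longrightarrow> a l * z T = koszul a w T"
  shows "koszul_cocycle a (insert l I) i (glue l z w)"
  unfolding koszul_cocycle_insert_iff[OF assms(1,2)]
  unfolding koszul_cocycle_def
proof (intro conjI allI impI)
  fix T assume "T \<subseteq> I" "card T = Suc i"
  then show "koszul a (glue l z w) T = 0"
    using assms(2,3) by (subst koszul_glue) (auto simp: koszul_cocycle_def)
next
  fix T assume subset: "T \<subseteq> I" "card T = i"
  then have "l \<notin> T" using assms(2) by blast
  with assms(4)[OF subset] show "a l * glue l z w T = koszul a (slice l (glue l z w)) T"
    by (simp add: koszul_slice_glue) (simp add: glue_def)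
qed

lemma koszul_cocycle_extend_insert:
  assumes "finite I" "l \<notin> I" "koszul_cocycle a I i z" "koszul_coboundary a I i (\<lambda>T. a l * z T)"
  obtains c where "koszul_cocycle a (insert l I) i c" "\<And>T. T \<subseteq> I \<Longrightarrow> c T = z T"
proof -
  obtain w where "\<And>T. T \<subseteq> I \<Longrightarrow> card T = i \<Longrightarrow> a l * z T = koszul a w T"
    using assms(4) by (auto simp: koszul_coboundary_def)
  with assms(1-3) have "koszul_cocycle a (insert l I) i (glue l z w)"
    by (rule koszul_cocycle_glue)
  moreover have "glue l z w T = z T" if "T \<subseteq> I" for T
    using that assms(2) by (auto simp: glue_def)
  ultimately show ?thesis by (rule that)
qed

lemma koszul_cocycle_extend:
  assumes "finite J" "I \<subseteq> J" and exact: "koszul_exact_below a I r" and "koszul_cocycle a I r z"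
    and coboundary: "\<And>l. l \<in> J - I \<Longrightarrow> koszul_coboundary a I r (\<lambda>T. a l * z T)"
  obtains c where "koszul_cocycle a J r c" "\<And>T. T \<subseteq> I \<Longrightarrow> c T = z T"
proof -
  have "\<exists>c. koszul_cocycle a J r c \<and> (\<forall>T\<subseteq>I. c T = z T)"
    using assms(1,2)
  proof (induction rule: finite_superset_induct)
    case base
    show ?case using assms(4) by blast
  next
    case (insert l K)
    then obtain c where cocycle: "koszul_cocycle a K r c" and extends: "\<And>T. T \<subseteq> I \<Longrightarrow> c T = z T"
      by blast
    have "koszul_coboundary a I r (\<lambda>T. a l * c T)"
      using koszul_coboundary_cong[of I r "\<lambda>T. a l * c T" "\<lambda>T. a l * z T" a] coboundary[of l]
        insert.hyps extends by auto
    with insert.hyps(1,2) exact koszul_cocycle_mult[OF cocycle]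
    have "koszul_coboundary a K r (\<lambda>T. a l * c T)" by (rule koszul_coboundary_superset)
    with insert.hyps(1,4) cocycle obtain c' where
      "koszul_cocycle a (insert l K) r c'" "\<And>T. T \<subseteq> K \<Longrightarrow> c' T = c T"
      by (rule koszul_cocycle_extend_insert) blast
    then show ?case using extends insert.hyps(2) by (metis subset_trans)
  qed
  then show ?thesis using that by blast
qed

lemma koszul_exact_remove:
  assumes "finite I" "l \<notin> I" "koszul_exact a (insert l I) i" "a l \<in> ideal.span (a ` I)"
  shows "koszul_exact a I i"
  unfolding koszul_exact_def
proof (intro allI impI)
  fix c assume cocycle: "koszul_cocycle a I i c"
  obtain c' where "koszul_cocycle a (insert l I) i c'" and extends: "\<And>T. T \<subseteq> I \<Longrightarrow> c' T = c T"
    using koszul_cocycle_extend_insert[OF assms(1,2) cocycle]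
      koszul_coboundary_ideal_mult[OF assms(1) cocycle assms(4)] by blast
  then have "koszul_coboundary a I i c'"
    using assms(3) by (auto simp: koszul_exact_def intro: koszul_coboundary_subset)
  then show "koszul_coboundary a I i c" using extends by (simp cong: koszul_coboundary_cong)
qed

lemma koszul_exact_subset:
  assumes "finite J" "I \<subseteq> J" "koszul_exact a J i" and span: "a ` (J - I) \<subseteq> ideal.span (a ` I)"
  shows "koszul_exact a I i"
proof -
  have "koszul_exact a J i \<longrightarrow> koszul_exact a I i"
    using assms(1,2)
  proof (induction rule: finite_superset_induct)
    case (insert l K)
    have "ideal.span (a ` I) \<subseteq> ideal.span (a ` K)"
      using insert.hyps(2) by (intro ideal.span_mono image_mono)
    moreover have "a l \<in> ideal.span (a ` I)" using span insert.hyps by auto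
    ultimately show ?case using insert by (blast intro: koszul_exact_remove)
  qed simp
  with assms(3) show ?thesis by blast
qed

text \<open>
  The restrictions to I and to L are both injective on cohomology in degree r, so one detects the
  vanishing of the other.
\<close>
lemma koszul_cocycle_top_value_in_span:
  assumes "finite J" "I \<subseteq> J" "L \<subseteq> J" "card I = r" "card L = r"
    and exact: "koszul_exact_below a I r" and span: "a ` (J - L) \<subseteq> ideal.span (a ` L)"
    and cocycle: "koszul_cocycle a J r c" and value_L: "c L \<in> ideal.span (a ` L)"
  shows "c I \<in> ideal.span (a ` I)"
proof -
  have fin: "finite I" "finite L" using assms(1-3) by (auto intro: finite_subset)
  have "koszul_exact_below a L r"
    using koszul_exact_below_superset[OF assms(1,2) exact] koszul_exact_subset[OF assms(1,3) _ span]
    by (simp add: koszul_exact_below_def)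
  moreover have "koszul_coboundary a L r c"
    using koszul_coboundary_top_iff[OF fin(2)] value_L assms(5) by blast
  ultimately have "koszul_coboundary a J r c"
    using assms(1,3) cocycle koszul_coboundary_superset by blast
  then have "koszul_coboundary a I r c" using assms(2) by (rule koszul_coboundary_subset)
  then show ?thesis using koszul_coboundary_top_iff[OF fin(1)] assms(4) by blast
qed

lemma koszul_exact_below_regular_insert:
  assumes "finite I" "l \<notin> I" and exact: "koszul_exact_below a I (card I)"
    and regular: "\<And>u. a l * u \<in> ideal.span (a ` I) \<Longrightarrow> u \<in> ideal.span (a ` I)"
  shows "koszul_exact_below a (insert l I) (Suc (card I))"
proof -
  have "koszul_exact a (insert l I) (card I)"
    unfolding koszul_exact_def
  proof (intro allI impI)
    fix c assume cocycle: "koszul_cocycle a (insert l I) (card I) c"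
    then have "a l * c I \<in> ideal.span (a ` I)"
      by (auto simp: koszul_cocycle_insert_iff[OF assms(1,2)] koszul_in_span)
    then have "koszul_coboundary a I (card I) c"
      using regular koszul_coboundary_top_iff[OF assms(1)] by blast
    with assms(1,2) exact cocycle show "koszul_coboundary a (insert l I) (card I) c"
      by (rule koszul_coboundary_insert)
  qed
  moreover have "koszul_exact_below a (insert l I) (card I)"
    using assms(1,2) exact by (rule koszul_exact_below_insert)
  ultimately show ?thesis by (simp add: koszul_exact_below_def less_Suc_eq)
qed

section \<open>Polynomials\<close>

definition filter_keys :: "('m \<Rightarrow> bool) \<Rightarrow> ('m \<Rightarrow>\<^sub>0 'b) \<Rightarrow> ('m \<Rightarrow>\<^sub>0 'b::zero)" where
  "filter_keys P q = Poly_Mapping.mapp (\<lambda>m c. c when P m) q"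

lemma lookup_filter_keys:
  "Poly_Mapping.lookup (filter_keys P q) m = (Poly_Mapping.lookup q m when P m)"
  by (auto simp: filter_keys_def lookup_mapp when_def in_keys_iff)

lemma keys_filter_keys: "Poly_Mapping.keys (filter_keys P q) = {m\<in>Poly_Mapping.keys q. P m}"
  by (auto simp: in_keys_iff lookup_filter_keys)

lemma filter_keys_zero [simp]: "filter_keys P 0 = 0"
  by (rule poly_mapping_eqI) (simp add: lookup_filter_keys)

lemma filter_keys_add: "filter_keys P (q + r) = filter_keys P q + filter_keys P r"
  by (rule poly_mapping_eqI) (simp add: lookup_filter_keys lookup_add when_add_distrib)

lemma filter_keys_sum: "filter_keys P (\<Sum>i\<in>A. q i) = (\<Sum>i\<in>A. filter_keys P (q i))"
  by (induction A rule: infinite_finite_induct) (simp_all add: filter_keys_add)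

lemma filter_keys_eq_self_iff: "filter_keys P q = q \<longleftrightarrow> (\<forall>m\<in>Poly_Mapping.keys q. P m)"
  by (auto simp: poly_mapping_eq_iff fun_eq_iff lookup_filter_keys when_def in_keys_iff)

lemma filter_keys_eq_0_iff: "filter_keys P q = 0 \<longleftrightarrow> (\<forall>m\<in>Poly_Mapping.keys q. \<not> P m)"
  by (auto simp: poly_mapping_eq_iff fun_eq_iff lookup_filter_keys when_def in_keys_iff)

lemma filter_keys_mult:
  assumes "\<And>t m. t \<in> Poly_Mapping.keys a \<Longrightarrow> P (t + m) \<longleftrightarrow> P' m"
  shows "filter_keys P (a * q) = a * filter_keys P' q"
proof -
  define r where "r = filter_keys (\<lambda>m. \<not> P' m) q"
  have "q = filter_keys P' q + r"
    by (rule poly_mapping_eqI) (auto simp: r_def lookup_filter_keys lookup_add when_def)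
  then have "filter_keys P (a * q) = filter_keys P (a * filter_keys P' q) + filter_keys P (a * r)"
    by (metis distrib_left filter_keys_add)
  also have "filter_keys P (a * filter_keys P' q) = a * filter_keys P' q"
    using keys_mult[of a "filter_keys P' q"] assms
    by (auto simp: filter_keys_eq_self_iff keys_filter_keys)
  also have "filter_keys P (a * r) = 0"
    using keys_mult[of a r] assms by (auto simp: filter_keys_eq_0_iff keys_filter_keys r_def)
  finally show ?thesis by simp
qed

lemma filter_keys_koszul:
  fixes a :: "'i::linorder \<Rightarrow> 'm::comm_monoid_add \<Rightarrow>\<^sub>0 'b::comm_ring_1"
  assumes "\<And>i t m. i \<in> T \<Longrightarrow> t \<in> Poly_Mapping.keys (a i) \<Longrightarrow> P T (t + m) \<longleftrightarrow> P (T - {i}) m"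
  shows "filter_keys (P T) (koszul a c T) = koszul a (\<lambda>S. filter_keys (P S) (c S)) T"
proof -
  have "Poly_Mapping.keys (koszul_sign i T * a i) = Poly_Mapping.keys (a i)" for i
    using koszul_sign_cases[of i T, where 'r = "'m \<Rightarrow>\<^sub>0 'b"] by auto
  then show ?thesis
    unfolding koszul_def filter_keys_sum
    using assms by (intro sum.cong refl filter_keys_mult) simp
qed

lemma sum_single_lookup:
  "(\<Sum>m\<in>Poly_Mapping.keys q. Poly_Mapping.single m (Poly_Mapping.lookup q m)) = q"
  by (rule poly_mapping_eqI) (auto simp: lookup_sum lookup_single when_def sum.delta in_keys_iff)

lemma lookup_single_mult:
  fixes q :: "'m::{comm_monoid_add, cancel_semigroup_add} \<Rightarrow>\<^sub>0 'b::comm_ring_1"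
  shows "Poly_Mapping.lookup (Poly_Mapping.single t c * q) (t + m) = c * Poly_Mapping.lookup q m"
proof -
  have "Poly_Mapping.single t c * q = Poly_Mapping.single t c *
      (\<Sum>m\<in>Poly_Mapping.keys q. Poly_Mapping.single m (Poly_Mapping.lookup q m))"
    by (simp add: sum_single_lookup)
  then show ?thesis
    by (auto simp: sum_distrib_left mult_single lookup_sum lookup_single when_def sum.delta
        in_keys_iff)
qed

lemma keys_monomial_mult:
  fixes q :: "'m::{comm_monoid_add, cancel_semigroup_add} \<Rightarrow>\<^sub>0 'b::comm_ring_1"
  shows "Poly_Mapping.keys (Poly_Mapping.single t 1 * q) = (+) t ` Poly_Mapping.keys q"
proof
  show "Poly_Mapping.keys (Poly_Mapping.single t 1 * q) \<subseteq> (+) t ` Poly_Mapping.keys q"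
    using keys_mult[of "Poly_Mapping.single t 1" q] by auto
  show "(+) t ` Poly_Mapping.keys q \<subseteq> Poly_Mapping.keys (Poly_Mapping.single t 1 * q)"
    by (auto simp: in_keys_iff lookup_single_mult)
qed

lemma lookup_map_times [simp]:
  "Poly_Mapping.lookup (Poly_Mapping.map ((*) k) m) i = k * Poly_Mapping.lookup m i" for k :: nat
  by (simp add: map.rep_eq when_def)

lemma single_power:
  "Poly_Mapping.single m c ^ k = Poly_Mapping.single (Poly_Mapping.map ((*) k) m) (c ^ k)"
  for m :: "'i \<Rightarrow>\<^sub>0 nat" and c :: "'b::comm_ring_1"
proof (induction k)
  case 0
  have "Poly_Mapping.map ((*) 0) m = 0" by (rule poly_mapping_eqI) simp
  then show ?case by (simp only: power_0 single_one)
next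
  case (Suc k)
  have "m + Poly_Mapping.map ((*) k) m = Poly_Mapping.map ((*) (Suc k)) m"
    by (rule poly_mapping_eqI) (simp add: lookup_add)
  with Suc show ?case by (simp add: mult_single del: mult_Suc)
qed

lemma var_power: "var i ^ k = Poly_Mapping.single (Poly_Mapping.single i k) 1"
  by (simp add: var_def single_power)

lemma X_power: "finite T \<Longrightarrow> X T ^ k = Poly_Mapping.single (\<Sum>i\<in>T. Poly_Mapping.single i k) 1"
proof (induction T rule: finite_induct)
  case (insert i T)
  then show ?case by (simp add: X_def power_mult_distrib var_power mult_single)
qed (simp add: X_def)

lemma X_eq_var_mult: "finite T \<Longrightarrow> i \<in> T \<Longrightarrow> X T = var i * X (T - {i})"
  by (simp add: X_def prod.remove)

lemma CHAR_poly_mapping: "CHAR('m::comm_monoid_add \<Rightarrow>\<^sub>0 'b::comm_ring_1) = CHAR('b)"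
proof (rule CHAR_eqI)
  have "(of_nat CHAR('b) :: 'm \<Rightarrow>\<^sub>0 'b) = Poly_Mapping.single 0 (of_nat CHAR('b))"
    by (rule single_of_nat[symmetric])
  then show "of_nat CHAR('b) = (0 :: 'm \<Rightarrow>\<^sub>0 'b)" by simp
  fix k assume "of_nat k = (0 :: 'm \<Rightarrow>\<^sub>0 'b)"
  then have "Poly_Mapping.lookup (of_nat k :: 'm \<Rightarrow>\<^sub>0 'b) 0 = 0" by simp
  then show "CHAR('b) dvd k" by (simp add: lookup_of_nat of_nat_eq_0_iff_char_dvd)
qed

lemma of_nat_dvd_1_poly_mapping:
  assumes "\<not> CHAR('b) dvd k"
  shows "(of_nat k :: 'm::comm_monoid_add \<Rightarrow>\<^sub>0 'b::field) dvd 1"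
proof
  have "of_nat k * Poly_Mapping.single 0 (inverse (of_nat k))
      = (Poly_Mapping.single 0 (of_nat k * inverse (of_nat k)) :: 'm \<Rightarrow>\<^sub>0 'b)"
    by (simp add: mult_single del: single_of_nat flip: single_of_nat)
  then show "1 = of_nat k * (Poly_Mapping.single 0 (inverse (of_nat k)) :: 'm \<Rightarrow>\<^sub>0 'b)"
    using assms by (simp add: of_nat_eq_0_iff_char_dvd)
qed

lemma lookup_power_CHAR:
  fixes q :: "('i \<Rightarrow>\<^sub>0 nat) \<Rightarrow>\<^sub>0 'b::comm_ring_1"
  assumes "prime CHAR('b)"
  shows "Poly_Mapping.lookup (q ^ CHAR('b)) (Poly_Mapping.map ((*) CHAR('b)) m)
    = Poly_Mapping.lookup q m ^ CHAR('b)"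
proof -
  let ?p = "CHAR('b)"
  have "?p > 0" using assms by (rule prime_gt_0_nat)
  then have inj: "Poly_Mapping.map ((*) ?p) m = Poly_Mapping.map ((*) ?p) m' \<longleftrightarrow> m = m'"
    for m m' :: "'i \<Rightarrow>\<^sub>0 nat"
    by (auto simp: poly_mapping_eq_iff fun_eq_iff)
  have "q ^ ?p = (\<Sum>m\<in>Poly_Mapping.keys q. Poly_Mapping.single m (Poly_Mapping.lookup q m)) ^ ?p"
    by (simp add: sum_single_lookup)
  also have "\<dots> = (\<Sum>m\<in>Poly_Mapping.keys q. Poly_Mapping.single m (Poly_Mapping.lookup q m) ^ ?p)"
    using assms by (intro freshmans_dream_sum) (auto simp: CHAR_poly_mapping)
  finally show ?thesis
    using \<open>?p > 0\<close>
    by (auto simp: single_power lookup_sum lookup_single inj when_def sum.delta in_keys_iff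
        power_0_left)
qed

section \<open>Degrees\<close>

lemma tdeg_eq_sum:
  assumes "finite A" "Poly_Mapping.keys m \<subseteq> A"
  shows "tdeg m = (\<Sum>i\<in>A. Poly_Mapping.lookup m i)"
  unfolding tdeg_def using assms by (intro sum.mono_neutral_left) (auto simp: in_keys_iff)

lemma tdeg_add: "tdeg (m + m') = tdeg m + tdeg m'"
proof -
  define A where "A = Poly_Mapping.keys m \<union> Poly_Mapping.keys m'"
  have "finite A" "Poly_Mapping.keys m \<subseteq> A" "Poly_Mapping.keys m' \<subseteq> A"
    "Poly_Mapping.keys (m + m') \<subseteq> A"
    using keys_add[of m m'] by (auto simp: A_def)
  then show ?thesis by (simp add: tdeg_eq_sum[of A] lookup_add sum.distrib)
qed

lemma tdeg_single [simp]: "tdeg (Poly_Mapping.single i k) = k"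
  by (simp add: tdeg_def)

lemma tdeg_sum: "tdeg (\<Sum>i\<in>A. m i) = (\<Sum>i\<in>A. tdeg (m i))"
  by (induction A rule: infinite_finite_induct) (simp_all add: tdeg_def[of 0] tdeg_add)

lemma homogeneous_var_power: "homogeneous k (var i ^ k :: 'a::comm_ring_1 mpoly)"
  by (auto simp: var_power homogeneous_def)

lemma homogeneous_X_power: "finite T \<Longrightarrow> homogeneous (card T * k) (X T ^ k :: 'a::comm_ring_1 mpoly)"
  by (auto simp: X_power homogeneous_def tdeg_sum)

definition tdeg_le :: "int \<Rightarrow> 'a::zero mpoly \<Rightarrow> bool" where
  "tdeg_le b q \<longleftrightarrow> (\<forall>m\<in>Poly_Mapping.keys q. int (tdeg m) \<le> b)"

lemma tdeg_le_mono: "tdeg_le b q \<Longrightarrow> b \<le> b' \<Longrightarrow> tdeg_le b' q"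
  by (force simp: tdeg_le_def)

lemma homogeneous_imp_tdeg_le: "homogeneous d q \<Longrightarrow> tdeg_le (int d) q"
  by (simp add: tdeg_le_def homogeneous_def)

lemma tdeg_le_mult: "tdeg_le b q \<Longrightarrow> tdeg_le b' r \<Longrightarrow> tdeg_le (b + b') (q * r)"
  using keys_mult[of q r] by (force simp: tdeg_le_def tdeg_add)

lemma tdeg_le_power: "tdeg_le b q \<Longrightarrow> tdeg_le (int k * b) (q ^ k)" for q :: "'a::comm_ring_1 mpoly"
proof (induction k)
  case 0
  show ?case by (simp add: tdeg_le_def tdeg_def)
next
  case (Suc k)
  then have "tdeg_le (b + int k * b) (q * q ^ k)" by (intro tdeg_le_mult)
  then show ?case by (simp add: algebra_simps)
qed

lemma tdeg_le_sum: "(\<And>i. i \<in> A \<Longrightarrow> tdeg_le b (q i)) \<Longrightarrow> tdeg_le b (\<Sum>i\<in>A. q i)"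
  using keys_sum[of q A] by (fastforce simp: tdeg_le_def)

lemma tdeg_le_koszul:
  assumes "\<And>i. i \<in> T \<Longrightarrow> homogeneous d (a i)" "\<And>i. i \<in> T \<Longrightarrow> tdeg_le b (c (T - {i}))"
  shows "tdeg_le (int d + b) (koszul a c T)"
  unfolding koszul_def
proof (rule tdeg_le_sum)
  fix i assume "i \<in> T"
  then have "homogeneous d (koszul_sign i T * a i)"
    using koszul_sign_cases[of i T, where 'r = "'b mpoly"] assms(1) by (auto simp: homogeneous_def)
  then show "tdeg_le (int d + b) (koszul_sign i T * a i * c (T - {i}))"
    using \<open>i \<in> T\<close> assms(2) by (intro tdeg_le_mult homogeneous_imp_tdeg_le)
qed

lemma tdeg_le_homogeneous_multD:
  fixes f :: "'a::idom mpoly"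
  assumes "homogeneous d f" "f \<noteq> 0" "tdeg_le (int d + b) (f * q)"
  shows "tdeg_le b q"
proof -
  have "f * filter_keys (\<lambda>m. \<not> int (tdeg m) \<le> b) q
      = filter_keys (\<lambda>m. \<not> int (tdeg m) \<le> int d + b) (f * q)"
    using assms(1) by (intro filter_keys_mult[symmetric]) (auto simp: homogeneous_def tdeg_add)
  also have "\<dots> = 0" using assms(3) by (simp add: filter_keys_eq_0_iff tdeg_le_def)
  finally show ?thesis using assms(2) by (simp add: filter_keys_eq_0_iff tdeg_le_def)
qed

section \<open>Ideals of powers of variables\<close>

lemma in_monomial_ideal_iff:
  fixes q :: "'m::comm_monoid_add \<Rightarrow>\<^sub>0 'b::comm_ring_1"
  shows "q \<in> ideal.span ((\<lambda>t. Poly_Mapping.single t 1) ` G) \<longleftrightarrow>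
    (\<forall>m\<in>Poly_Mapping.keys q. \<exists>t\<in>G. \<exists>s. m = s + t)" (is "q \<in> ?ideal \<longleftrightarrow> ?divisible q")
proof
  assume "q \<in> ?ideal"
  then show "?divisible q"
  proof (induction rule: ideal.span_induct_alt)
    case (step c x y)
    then obtain t where "t \<in> G" and x: "x = Poly_Mapping.single t 1" by blast
    then have "Poly_Mapping.keys (c * x) \<subseteq> {s + t |s. True}"
      using keys_mult[of c x] by auto
    then show ?case
      using \<open>t \<in> G\<close> step.IH keys_add[of "c * x" y] by blast
  qed simp
next
  assume divisible: "?divisible q"
  have "Poly_Mapping.single m (Poly_Mapping.lookup q m) \<in> ?ideal"
    if m_in: "m \<in> Poly_Mapping.keys q" for m
  proof -
    obtain s t where "t \<in> G" and m: "m = s + t" using divisible m_in by blast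
    then have "Poly_Mapping.single s (Poly_Mapping.lookup q m) * Poly_Mapping.single t 1 \<in> ?ideal"
      by (intro ideal.span_scale ideal.span_base) simp
    then show ?thesis by (simp add: m mult_single)
  qed
  then have "(\<Sum>m\<in>Poly_Mapping.keys q. Poly_Mapping.single m (Poly_Mapping.lookup q m)) \<in> ?ideal"
    by (rule ideal.span_sum)
  then show "q \<in> ?ideal" by (simp add: sum_single_lookup)
qed

abbreviation var_powers_ideal :: "nat \<Rightarrow> nat set \<Rightarrow> 'a::comm_ring_1 mpoly set" where
  "var_powers_ideal N A \<equiv> ideal.span ((\<lambda>i. var i ^ N) ` A)"

lemma eq_add_single_iff: "(\<exists>s. m = s + Poly_Mapping.single i N) \<longleftrightarrow> N \<le> Poly_Mapping.lookup m i"
  for m :: "'i \<Rightarrow>\<^sub>0 nat"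
proof
  assume "N \<le> Poly_Mapping.lookup m i"
  then have "m = m - Poly_Mapping.single i N + Poly_Mapping.single i N"
    by (intro poly_mapping_eqI) (auto simp: lookup_add lookup_minus lookup_single when_def)
  then show "\<exists>s. m = s + Poly_Mapping.single i N" by blast
qed (auto simp: lookup_add)

lemma in_var_powers_ideal_iff:
  "q \<in> var_powers_ideal N A \<longleftrightarrow> (\<forall>m\<in>Poly_Mapping.keys q. \<exists>i\<in>A. N \<le> Poly_Mapping.lookup m i)"
proof -
  have "(\<lambda>i. var i ^ N :: 'a mpoly) ` A
      = (\<lambda>t. Poly_Mapping.single t 1) ` (\<lambda>i. Poly_Mapping.single i N) ` A"
    by (simp add: var_power image_image)
  then show ?thesis by (simp add: in_monomial_ideal_iff eq_add_single_iff)
qed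

lemma var_power_mult_in_var_powers_idealD:
  assumes "l \<notin> A" "var l ^ k * q \<in> var_powers_ideal N A"
  shows "q \<in> var_powers_ideal N A"
proof -
  have "Poly_Mapping.lookup (Poly_Mapping.single l k + m) i = Poly_Mapping.lookup m i"
    if "i \<in> A" for i m
    using that assms(1) by (auto simp: lookup_add lookup_single when_def)
  with assms(2) show ?thesis
    unfolding in_var_powers_ideal_iff by (simp add: var_power keys_monomial_mult)
qed

lemma X_power_mult_in_var_powers_ideal_iff:
  assumes "finite A"
  shows "X A ^ M * q \<in> var_powers_ideal (N + M) A \<longleftrightarrow> q \<in> var_powers_ideal N A"
proof -
  have "Poly_Mapping.lookup ((\<Sum>i\<in>A. Poly_Mapping.single i M) + m) i = M + Poly_Mapping.lookup m i"
    if "i \<in> A" for i m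
    using that assms by (simp add: lookup_add lookup_sum lookup_single when_def sum.delta)
  then show ?thesis using assms by (simp add: in_var_powers_ideal_iff X_power keys_monomial_mult)
qed

lemma power_CHAR_in_var_powers_idealD:
  fixes q :: "'a::idom mpoly"
  assumes "prime CHAR('a)" "q ^ CHAR('a) \<in> var_powers_ideal (CHAR('a) * K) A"
  shows "q \<in> var_powers_ideal K A"
  unfolding in_var_powers_ideal_iff
proof
  fix m assume "m \<in> Poly_Mapping.keys q"
  then have "Poly_Mapping.map ((*) CHAR('a)) m \<in> Poly_Mapping.keys (q ^ CHAR('a))"
    using lookup_power_CHAR[OF assms(1), of q m] by (simp add: in_keys_iff)
  then show "\<exists>i\<in>A. K \<le> Poly_Mapping.lookup m i"
    using assms(2) prime_gt_0_nat[OF assms(1)] by (force simp: in_var_powers_ideal_iff)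
qed

lemma koszul_exact_below_var_powers:
  assumes "finite I" "inj_on v I" "\<And>i. i \<in> I \<Longrightarrow> a i = var (v i) ^ N"
  shows "koszul_exact_below a I (card I)"
  using assms
proof (induction I rule: finite_induct)
  case empty
  show ?case by (simp add: koszul_exact_below_def)
next
  case (insert l I)
  have span: "ideal.span (a ` I) = var_powers_ideal N (v ` I)"
    using insert.prems(2) by (simp add: image_image)
  have "v l \<notin> v ` I" using insert.hyps(2) insert.prems(1) by auto
  then have "u \<in> ideal.span (a ` I)" if "a l * u \<in> ideal.span (a ` I)" for u
    using that insert.prems(2)[of l] var_power_mult_in_var_powers_idealD[of "v l" "v ` I" N u N]
    by (simp add: span)
  moreover have "koszul_exact_below a I (card I)" using insert by (simp add: inj_on_def)
  ultimately have "koszul_exact_below a (insert l I) (Suc (card I))"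
    using insert.hyps by (intro koszul_exact_below_regular_insert)
  then show ?case using insert.hyps by simp
qed

section \<open>Macaulay's bound\<close>

text \<open>When \<open>a\<^sub>i\<close> has degree \<open>D i\<close>, this shift makes the Koszul differential degree-preserving.\<close>
definition truncate ::
    "('i \<Rightarrow> nat) \<Rightarrow> int \<Rightarrow> ('i set \<Rightarrow> 'a::zero mpoly) \<Rightarrow> 'i set \<Rightarrow> 'a mpoly" where
  "truncate D \<sigma> c T = filter_keys (\<lambda>m. int (tdeg m) \<le> \<sigma> + (\<Sum>i\<in>T. int (D i))) (c T)"

lemma koszul_cocycle_truncate:
  assumes "finite I" and hom: "\<And>i. i \<in> I \<Longrightarrow> homogeneous (D i) (a i)"
    and cocycle: "koszul_cocycle a I r c"
  shows "koszul_cocycle a I r (truncate D \<sigma> c)"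
  unfolding koszul_cocycle_def
proof (intro allI impI)
  fix T assume subset: "T \<subseteq> I" "card T = Suc r"
  have "(\<Sum>j\<in>T. int (D j)) = int (D i) + (\<Sum>j\<in>T - {i}. int (D j))" if "i \<in> T" for i
    using that subset assms(1) by (simp add: sum.remove finite_subset)
  then have "koszul a (truncate D \<sigma> c) T
      = filter_keys (\<lambda>m. int (tdeg m) \<le> \<sigma> + (\<Sum>i\<in>T. int (D i))) (koszul a c T)"
    unfolding truncate_def using hom subset(1)
    by (intro filter_keys_koszul[symmetric]) (auto simp: homogeneous_def tdeg_add subset_iff)
  then show "koszul a (truncate D \<sigma> c) T = 0" using cocycle subset by (simp add: koszul_cocycle_def)
qed

lemma koszul_socle_degree_bound:
  fixes a :: "'i::linorder \<Rightarrow> 'a::comm_ring_1 mpoly"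
  assumes "finite I" "finite L" "card L = card I" and exact: "koszul_exact_below a I (card I)"
    and hom: "\<And>i. i \<in> I \<union> L \<Longrightarrow> homogeneous (D i) (a i)"
    and span: "a ` I \<subseteq> ideal.span (a ` L)"
    and deg: "tdeg_le ((\<Sum>i\<in>I. int (D i)) - (\<Sum>i\<in>L. int (D i)) - 1) u"
    and ann: "\<And>l. l \<in> L \<Longrightarrow> a l * u \<in> ideal.span (a ` I)"
  shows "u \<in> ideal.span (a ` I)"
proof -
  define \<sigma> where "\<sigma> = - (\<Sum>i\<in>L. int (D i)) - 1"
  have fin: "finite (I \<union> L)" using assms(1,2) by simp
  have "koszul_coboundary a I (card I) (\<lambda>T. a l * u)" if "l \<in> I \<union> L - I" for l
    using that ann koszul_coboundary_top_iff[OF assms(1), of a "\<lambda>T. a l * u"] by blast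
  then obtain c where cocycle: "koszul_cocycle a (I \<union> L) (card I) c" and "c I = u"
    using koszul_cocycle_extend[OF fin _ exact, of "\<lambda>T. u"] koszul_cocycle_top[OF assms(1), of a]
    by (metis Un_upper1 order_refl)
  have "truncate D \<sigma> c I \<in> ideal.span (a ` I)"
  proof (rule koszul_cocycle_top_value_in_span[OF fin Un_upper1 Un_upper2 refl assms(3) exact])
    show "a ` (I \<union> L - L) \<subseteq> ideal.span (a ` L)" using span by blast
    show "koszul_cocycle a (I \<union> L) (card I) (truncate D \<sigma> c)"
      using fin hom cocycle by (rule koszul_cocycle_truncate)
    have "truncate D \<sigma> c L = 0" by (simp add: truncate_def \<sigma>_def filter_keys_eq_0_iff)
    then show "truncate D \<sigma> c L \<in> ideal.span (a ` L)" by (simp add: ideal.span_zero)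
  qed
  moreover have "truncate D \<sigma> c I = u"
    using deg \<open>c I = u\<close>
    by (simp add: truncate_def \<sigma>_def filter_keys_eq_self_iff tdeg_le_def algebra_simps)
  ultimately show ?thesis by simp
qed

lemma macaulay_bound:
  fixes F :: "nat \<Rightarrow> 'a::comm_ring_1 mpoly"
  assumes "finite A" "finite B" "card B = card A"
    and hom: "\<And>j. j \<in> B \<Longrightarrow> homogeneous (e j) (F j)"
    and powers: "\<And>i. i \<in> A \<Longrightarrow> var i ^ N \<in> ideal.span (F ` B)"
    and deg: "tdeg_le (int (card A * N) - (\<Sum>j\<in>B. int (e j)) - 1) u"
    and ann: "\<And>j. j \<in> B \<Longrightarrow> F j * u \<in> var_powers_ideal N A"
  shows "u \<in> var_powers_ideal N A"
proof -
  define a where "a = (\<lambda>(b, i). if b then F i else var i ^ N)"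
  define D where "D = (\<lambda>(b, i). if b then e i else N)"
  define I where "I = Pair False ` A"
  define L where "L = Pair True ` B"
  have fin: "finite I" "finite L" using assms by (simp_all add: I_def L_def)
  have card: "card I = card A" "card L = card A"
    using assms by (simp_all add: I_def L_def card_image inj_on_def)
  have image: "a ` I = (\<lambda>i. var i ^ N) ` A" "a ` L = F ` B"
    by (simp_all add: a_def I_def L_def image_image)
  have degrees: "(\<Sum>i\<in>I. int (D i)) = int (card A * N)" "(\<Sum>i\<in>L. int (D i)) = (\<Sum>j\<in>B. int (e j))"
    by (simp_all add: D_def I_def L_def sum.reindex inj_on_def)
  have "inj_on snd I" "\<And>i. i \<in> I \<Longrightarrow> a i = var (snd i) ^ N"
    by (auto simp: I_def a_def inj_on_def)
  with fin(1) have exact: "koszul_exact_below a I (card I)" by (rule koszul_exact_below_var_powers)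
  have "u \<in> ideal.span (a ` I)"
  proof (rule koszul_socle_degree_bound[OF fin _ exact])
    show "homogeneous (D i) (a i)" if "i \<in> I \<union> L" for i
      using that hom by (auto simp: a_def D_def I_def L_def homogeneous_var_power)
    show "a ` I \<subseteq> ideal.span (a ` L)" unfolding image using powers by blast
    show "a l * u \<in> ideal.span (a ` I)" if "l \<in> L" for l
      unfolding image using that ann by (auto simp: a_def L_def)
  qed (use deg in \<open>simp_all add: card degrees\<close>)
  then show ?thesis by (simp add: image)
qed

text \<open>
  For a class \<open>u / (\<Prod>i\<in>A. x\<^sub>i)\<^sup>N\<close> of top local cohomology no relation between N and the exponent M is
  needed, because the fraction may be expanded by \<open>(\<Prod>i\<in>A. x\<^sub>i)\<^sup>M\<close>.
\<close>
lemma macaulay_bound_local_cohomology: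
  fixes F :: "nat \<Rightarrow> 'a::comm_ring_1 mpoly"
  assumes fin: "finite A" "finite B" "card B = card A"
    and hom: "\<And>j. j \<in> B \<Longrightarrow> homogeneous (e j) (F j)"
    and powers: "\<And>i. i \<in> A \<Longrightarrow> var i ^ M \<in> ideal.span (F ` B)"
    and deg: "tdeg_le (int (card A * N) - (\<Sum>j\<in>B. int (e j)) - 1) u"
    and ann: "\<And>j. j \<in> B \<Longrightarrow> F j * u \<in> var_powers_ideal N A"
  shows "u \<in> var_powers_ideal N A"
proof -
  have "X A ^ M * u \<in> var_powers_ideal (N + M) A"
  proof (rule macaulay_bound[OF fin hom])
    show "var i ^ (N + M) \<in> ideal.span (F ` B)" if "i \<in> A" for i
      unfolding power_add using powers[OF that] by (rule ideal.span_scale)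
    show "F j * (X A ^ M * u) \<in> var_powers_ideal (N + M) A" if "j \<in> B" for j
      using ann[OF that] X_power_mult_in_var_powers_ideal_iff[OF fin(1), of M "F j * u" N]
      by (simp add: mult_ac)
    have "tdeg_le (int (card A * M) + (int (card A * N) - (\<Sum>j\<in>B. int (e j)) - 1)) (X A ^ M * u)"
      using deg by (intro tdeg_le_mult homogeneous_imp_tdeg_le homogeneous_X_power fin(1))
    then show "tdeg_le (int (card A * (N + M)) - (\<Sum>j\<in>B. int (e j)) - 1) (X A ^ M * u)"
      by (simp add: algebra_simps)
  qed
  then show ?thesis by (simp add: X_power_mult_in_var_powers_ideal_iff[OF fin(1)])
qed

section \<open>Partial derivatives\<close>

lemma pd_eq_sum:
  assumes "finite A" "Poly_Mapping.keys q \<subseteq> A"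
  shows "pd i q = (\<Sum>m\<in>A. Poly_Mapping.single (m - Poly_Mapping.single i 1)
    (of_nat (Poly_Mapping.lookup m i) * Poly_Mapping.lookup q m))"
  unfolding pd_def using assms by (intro sum.mono_neutral_left) (auto simp: in_keys_iff)

lemma pd_zero [simp]: "pd i 0 = 0"
  by (simp add: pd_def)

lemma pd_add: "pd i (q + r) = pd i q + pd i r"
proof -
  define A where "A = Poly_Mapping.keys q \<union> Poly_Mapping.keys r"
  have "finite A" "Poly_Mapping.keys q \<subseteq> A" "Poly_Mapping.keys r \<subseteq> A" "Poly_Mapping.keys (q + r) \<subseteq> A"
    using keys_add[of q r] by (auto simp: A_def)
  then show ?thesis
    by (simp add: pd_eq_sum[of A] lookup_add distrib_left single_add sum.distrib)
qed

lemma pd_sum: "pd i (\<Sum>j\<in>A. q j) = (\<Sum>j\<in>A. pd i (q j))"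
  by (induction A rule: infinite_finite_induct) (simp_all add: pd_add)

lemma pd_single: "pd i (Poly_Mapping.single m c) =
    Poly_Mapping.single (m - Poly_Mapping.single i 1) (of_nat (Poly_Mapping.lookup m i) * c)"
  by (simp add: pd_eq_sum[of "{m}"])

lemma pd_single_mult_single:
  "pd i (Poly_Mapping.single m c) * Poly_Mapping.single m' c' =
    Poly_Mapping.single (m + m' - Poly_Mapping.single i 1) (of_nat (Poly_Mapping.lookup m i) * c * c')"
proof (cases "Poly_Mapping.lookup m i = 0")
  case True
  then show ?thesis by (simp add: pd_single)
next
  case False
  then have "m - Poly_Mapping.single i 1 + m' = m + m' - Poly_Mapping.single i 1"
    by (intro poly_mapping_eqI) (auto simp: lookup_add lookup_minus lookup_single when_def)
  then show ?thesis by (simp add: pd_single mult_single)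
qed

lemma pd_mult: "pd i (q * r) = pd i q * r + q * pd i r"
proof -
  define s where "s q m = Poly_Mapping.single m (Poly_Mapping.lookup q m)" for q :: "'a mpoly" and m
  have sum: "q = (\<Sum>m\<in>Poly_Mapping.keys q. s q m)" for q
    by (simp add: s_def sum_single_lookup)
  have leibniz: "pd i (s q m * s r m') = pd i (s q m) * s r m' + s q m * pd i (s r m')" for m m'
    using pd_single_mult_single[of i m "Poly_Mapping.lookup q m" m' "Poly_Mapping.lookup r m'"]
      pd_single_mult_single[of i m' "Poly_Mapping.lookup r m'" m "Poly_Mapping.lookup q m"]
    by (simp add: s_def mult_single pd_single lookup_add algebra_simps flip: single_add)
  have "pd i (q * r) = pd i ((\<Sum>m\<in>Poly_Mapping.keys q. s q m) * (\<Sum>m\<in>Poly_Mapping.keys r. s r m))"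
    by (simp flip: sum)
  also have "\<dots> = pd i (\<Sum>m\<in>Poly_Mapping.keys q. s q m) * (\<Sum>m\<in>Poly_Mapping.keys r. s r m)
      + (\<Sum>m\<in>Poly_Mapping.keys q. s q m) * pd i (\<Sum>m\<in>Poly_Mapping.keys r. s r m)"
    by (simp only: sum_product pd_sum leibniz sum.distrib)
  finally show ?thesis by (simp flip: sum)
qed

lemma pd_power: "pd i (q ^ k) = of_nat k * q ^ (k - 1) * pd i q"
proof (induction k)
  case 0
  show ?case using pd_single[of i 0 1] by simp
next
  case (Suc k)
  then show ?case by (cases k) (simp_all add: pd_mult algebra_simps)
qed

lemma pd_power_eq_zero:
  fixes q :: "'a::comm_ring_1 mpoly"
  assumes "CHAR('a) dvd N"
  shows "pd i (q ^ N) = 0"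
proof -
  have "(of_nat N :: 'a mpoly) = 0"
    using assms by (simp add: of_nat_eq_0_iff_char_dvd CHAR_poly_mapping)
  then show ?thesis by (simp add: pd_power)
qed

lemma homogeneous_pd:
  assumes "homogeneous d q"
  shows "homogeneous (d - 1) (pd i q)"
  unfolding homogeneous_def
proof
  fix m' assume "m' \<in> Poly_Mapping.keys (pd i q)"
  from subsetD[OF keys_sum this[unfolded pd_def]]
  obtain m where "m \<in> Poly_Mapping.keys q" and
    "m' \<in> Poly_Mapping.keys (Poly_Mapping.single (m - Poly_Mapping.single i 1)
      (of_nat (Poly_Mapping.lookup m i) * Poly_Mapping.lookup q m))"
    by blast
  from this(2) have "of_nat (Poly_Mapping.lookup m i) * Poly_Mapping.lookup q m \<noteq> 0"
    and m': "m' = m - Poly_Mapping.single i 1"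
    by (auto split: if_splits)
  then have "Poly_Mapping.lookup m i \<noteq> 0" by (metis mult_zero_left of_nat_0)
  with m' have "m = m' + Poly_Mapping.single i 1"
    by (intro poly_mapping_eqI) (auto simp: lookup_add lookup_minus lookup_single when_def)
  then have "tdeg m = tdeg m' + 1" by (metis tdeg_add tdeg_single)
  with assms \<open>m \<in> Poly_Mapping.keys q\<close> show "tdeg m' = d - 1" by (auto simp: homogeneous_def)
qed

lemma pd_in_var_powers_ideal:
  fixes q :: "'a::comm_ring_1 mpoly"
  assumes "CHAR('a) dvd N" "q \<in> var_powers_ideal N A"
  shows "pd i q \<in> var_powers_ideal N A"
  using assms(2)
proof (induction rule: ideal.span_induct_alt)
  case base
  show ?case by (simp add: ideal.span_zero)
next
  case (step c x y)
  then have "pd i x = 0" using assms(1) by (auto simp: pd_power_eq_zero)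
  then have "pd i (c * x + y) = pd i c * x + pd i y" by (simp add: pd_add pd_mult)
  with step show ?case
    by (simp add: ideal.span_add ideal.span_scale ideal.span_base)
qed

lemma pd_mult_in_var_powers_ideal:
  fixes f g :: "'a::field mpoly"
  assumes "CHAR('a) dvd N" "\<not> CHAR('a) dvd Suc t" "pd j g = 0"
    and "f ^ Suc t * g \<in> var_powers_ideal N A"
  shows "pd j f * (f ^ t * g) \<in> var_powers_ideal N A"
proof -
  have "of_nat (Suc t) * (pd j f * (f ^ t * g)) = pd j (f ^ Suc t * g)"
    unfolding pd_mult pd_power by (simp add: assms(3) mult_ac)
  also have "\<dots> \<in> var_powers_ideal N A"
    using assms(1,4) by (rule pd_in_var_powers_ideal)
  finally show ?thesis
    by (simp only: unit_mult_in_span_iff[OF of_nat_dvd_1_poly_mapping[OF assms(2)]])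
qed

lemma jacobian_m_primary_var_power:
  assumes "jacobian_m_primary n f"
  obtains N where "\<And>i. i \<le> n \<Longrightarrow> var i ^ N \<in> ideal.span ((\<lambda>j. pd j f) ` {0..n})"
proof -
  obtain N where powers: "\<forall>i\<le>n. \<exists>h. var i ^ N = (\<Sum>j\<le>n. h j * pd j f)"
    using assms unfolding jacobian_m_primary_def by blast
  have "var i ^ N \<in> ideal.span ((\<lambda>j. pd j f) ` {0..n})" if "i \<le> n" for i
  proof -
    obtain h where representation: "var i ^ N = (\<Sum>j\<le>n. h j * pd j f)" using powers \<open>i \<le> n\<close> by blast
    show ?thesis
      unfolding representation by (intro ideal.span_sum ideal.span_scale ideal.span_base) simp
  qed
  then show ?thesis using that by blast
qed

lemma jacobian_m_primary_pd_nonzero: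
  assumes "jacobian_m_primary n f"
  shows "\<exists>j. pd j f \<noteq> 0"
proof (rule ccontr)
  assume "\<nexists>j. pd j f \<noteq> 0"
  moreover obtain N where "var 0 ^ N \<in> ideal.span ((\<lambda>j. pd j f) ` {0..n})"
    using jacobian_m_primary_var_power[OF assms] by blast
  ultimately have "(var 0 ^ N :: 'a mpoly) \<in> ideal.span {0}" by (simp add: image_constant_conv)
  then show False
    by (auto simp: ideal.span_singleton var_power simp flip: keys_eq_empty)
qed

lemma pd_nonzero_imp_degree_pos:
  assumes "pd j f \<noteq> 0" "homogeneous d f"
  shows "d > 0"
proof (rule ccontr)
  assume "\<not> d > 0"
  then have "Poly_Mapping.lookup m j = 0" if "m \<in> Poly_Mapping.keys f" for m
    using assms(2) that by (auto simp: homogeneous_def tdeg_def in_keys_iff)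
  with assms(1) show False by (simp add: pd_def)
qed

section \<open>Frobenius on top local cohomology of R\<close>

lemma last_product_outside_var_powers_ideal:
  fixes f q :: "'a::idom mpoly"
  assumes "prime CHAR('a)" "q \<notin> var_powers_ideal K A"
    and "f ^ s * q ^ CHAR('a) \<in> var_powers_ideal (CHAR('a) * K) A"
  obtains t where "t < s" "f ^ t * q ^ CHAR('a) \<notin> var_powers_ideal (CHAR('a) * K) A"
    "f ^ Suc t * q ^ CHAR('a) \<in> var_powers_ideal (CHAR('a) * K) A"
proof -
  have "f ^ 0 * q ^ CHAR('a) \<notin> var_powers_ideal (CHAR('a) * K) A"
    using assms(1,2) power_CHAR_in_var_powers_idealD by auto
  with assms(3) show ?thesis
    using ex_least_nat_less[of "\<lambda>s. f ^ s * q ^ CHAR('a) \<in> var_powers_ideal (CHAR('a) * K) A" s] that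
    by blast
qed

lemma tdeg_le_frobenius_product:
  fixes f q :: "'a::comm_ring_1 mpoly" and n d p t :: nat
  assumes hom: "homogeneous d f" and deg: "tdeg_le (K - int d - 1) q"
    and "int p \<ge> int n * int d - int d - int n" "t + 2 \<le> p"
  shows "tdeg_le (int p * K - (int n + 1) * (int d - 1) - 1) (f ^ t * q ^ p)"
proof -
  have "tdeg_le (int t * int d + int p * (K - int d - 1)) (f ^ t * q ^ p)"
    using hom deg by (intro tdeg_le_mult tdeg_le_power homogeneous_imp_tdeg_le)
  moreover have "(int t + 2) * int d \<le> int p * int d"
    using assms(4) by (intro mult_right_mono) auto
  ultimately show ?thesis
    using assms(3) by (elim tdeg_le_mono) (simp add: algebra_simps)
qed

lemma frobenius_injective_on_numerators:
  fixes f q :: "'a::field mpoly" and n d p K :: nat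
  assumes char: "CHAR('a) = p" and prime: "prime p" and "d > 0"
    and hom: "homogeneous d f" and jac: "jacobian_m_primary n f"
    and pbound: "int p \<ge> int n * int d - int d - int n"
    and deg: "tdeg_le (int (K * Suc n) - int d - 1) q"
    and frob: "f ^ (p - 1) * q ^ p \<in> var_powers_ideal (p * K) {0..n}"
  shows "q \<in> var_powers_ideal K {0..n}"
proof (rule ccontr)
  assume "q \<notin> var_powers_ideal K {0..n}"
  then obtain t where "t < p - 1" and outside: "f ^ t * q ^ p \<notin> var_powers_ideal (p * K) {0..n}"
    and inside: "f ^ Suc t * q ^ p \<in> var_powers_ideal (p * K) {0..n}"
    using last_product_outside_var_powers_ideal[of q K "{0..n}" f "p - 1"] prime frob
    unfolding char by blast
  obtain M where powers: "\<And>i. i \<le> n \<Longrightarrow> var i ^ M \<in> ideal.span ((\<lambda>j. pd j f) ` {0..n})"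
    using jac by (rule jacobian_m_primary_var_power) blast
  have "f ^ t * q ^ p \<in> var_powers_ideal (p * K) {0..n}"
  proof (rule macaulay_bound_local_cohomology[where F = "\<lambda>j. pd j f" and B = "{0..n}" and M = M])
    show "homogeneous (d - 1) (pd j f)" for j using hom by (rule homogeneous_pd)
    show "pd j f * (f ^ t * q ^ p) \<in> var_powers_ideal (p * K) {0..n}" for j
    proof (rule pd_mult_in_var_powers_ideal)
      show "\<not> CHAR('a) dvd Suc t" using \<open>t < p - 1\<close> by (auto simp: char dest: dvd_imp_le)
      show "pd j (q ^ p) = 0" by (simp add: pd_power_eq_zero char)
    qed (use inside char in auto)
    have "t + 2 \<le> p" using \<open>t < p - 1\<close> by simp
    from tdeg_le_frobenius_product[OF hom deg pbound this]
    show "tdeg_le (int (card {0..n} * (p * K)) - (\<Sum>j\<in>{0..n}. int (d - 1)) - 1) (f ^ t * q ^ p)"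
      by (rule tdeg_le_mono) (use \<open>d > 0\<close> in \<open>simp add: algebra_simps of_nat_diff\<close>)
  qed (simp_all add: powers)
  with outside show False by contradiction
qed

section \<open>The subring R\<close>

lemma keys_add_nat: "Poly_Mapping.keys (m + m') = Poly_Mapping.keys m \<union> Poly_Mapping.keys m'"
  for m m' :: "'i \<Rightarrow>\<^sub>0 nat"
  by (auto simp: in_keys_iff lookup_add)

lemma in_R_mult: "in_R n q \<Longrightarrow> in_R n r \<Longrightarrow> in_R n (q * r)"
  using keys_mult[of q r] by (fastforce simp: in_R_def keys_add_nat)

lemma in_R_power: "in_R n q \<Longrightarrow> in_R n (q ^ k)" for q :: "'a::comm_ring_1 mpoly"
  by (induction k) (auto intro: in_R_mult simp: in_R_def[of n 1])

lemma in_R_diff: "in_R n q \<Longrightarrow> in_R n r \<Longrightarrow> in_R n (q - r)" for q :: "'a::comm_ring_1 mpoly"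
  using keys_diff[of q r] by (fastforce simp: in_R_def)

lemma in_R_var: "i \<le> n \<Longrightarrow> in_R n (var i :: 'a::comm_ring_1 mpoly)"
  by (auto simp: in_R_def var_def)

lemma in_R_X: "T \<subseteq> {0..n} \<Longrightarrow> in_R n (X T :: 'a::comm_ring_1 mpoly)"
proof (induction T rule: infinite_finite_induct)
  case (insert i T)
  then show ?case by (auto simp: X_def intro!: in_R_mult in_R_var)
qed (simp_all add: X_def in_R_def)

text \<open>
  Exactness is proved in the ring with infinitely many variables; this R-linear retraction brings the
  witnesses back into R.
\<close>
definition restrict_R :: "nat \<Rightarrow> 'a::zero mpoly \<Rightarrow> 'a mpoly" where
  "restrict_R n = filter_keys (\<lambda>m. Poly_Mapping.keys m \<subseteq> {0..n})"

lemma in_R_restrict_R [simp]: "in_R n (restrict_R n q)"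
  by (simp add: in_R_def restrict_R_def keys_filter_keys)

lemma restrict_R_id: "in_R n q \<Longrightarrow> restrict_R n q = q"
  by (simp add: restrict_R_def filter_keys_eq_self_iff in_R_def)

section \<open>The connecting homomorphism\<close>

lemma cech_num_eq_koszul: "cech_num k = koszul (\<lambda>i. var i ^ k)"
  by (intro ext) (simp add: cech_num_def koszul_def koszul_sign_def mult_ac)

lemma cech_num_rescale:
  assumes "finite T"
  shows "cech_num (k + e) (\<lambda>S. g S * X S ^ e) T = X T ^ e * cech_num k g T"
  unfolding cech_num_eq_koszul koszul_def sum_distrib_left
proof (rule sum.cong, rule refl)
  fix i assume "i \<in> T"
  then show "koszul_sign i T * var i ^ (k + e) * (g (T - {i}) * X (T - {i}) ^ e)
      = X T ^ e * (koszul_sign i T * var i ^ k * g (T - {i}))"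
    by (simp add: X_eq_var_mult[OF assms] power_add power_mult_distrib mult_ac)
qed

lemma cech_num_power_CHAR:
  fixes g :: "nat set \<Rightarrow> 'a::comm_ring_1 mpoly"
  assumes "prime CHAR('a)"
  shows "cech_num (CHAR('a) * k) (\<lambda>S. g S ^ CHAR('a)) T = cech_num k g T ^ CHAR('a)"
  using koszul_power_CHAR[where 'r = "'a mpoly", of "\<lambda>i. var i ^ k" g T] assms
  by (simp add: CHAR_poly_mapping cech_num_eq_koszul mult.commute[of "CHAR('a)"] power_mult)

lemma tdeg_le_cech_num:
  assumes "negative_n n k g"
  shows "tdeg_le (int (Suc n * k) - 1) (cech_num k g {0..n})"
proof -
  have "tdeg_le (int (k * n) - 1) (g (Sn n i))" if "i \<in> {0..n}" for i
    using assms that by (fastforce simp: negative_n_def tdeg_le_def simp del: of_nat_mult)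
  then have "tdeg_le (int k + (int (k * n) - 1)) (cech_num k g {0..n})"
    unfolding cech_num_eq_koszul by (intro tdeg_le_koszul homogeneous_var_power)
  then show ?thesis by (simp add: algebra_simps)
qed

lemma tdeg_le_connecting_numerator:
  fixes f :: "'a::idom mpoly"
  assumes "homogeneous d f" "f \<noteq> 0" "negative_n n k g"
    and numerator: "X {0..n} ^ e * cech_num k g {0..n} = q * f"
  shows "tdeg_le (int ((k + e) * Suc n) - int d - 1) q"
proof (rule tdeg_le_homogeneous_multD[OF assms(1,2)])
  have "tdeg_le (int (Suc n * e) + (int (Suc n * k) - 1)) (X {0..n} ^ e * cech_num k g {0..n})"
    using homogeneous_X_power[of "{0..n}" e] assms(3)
    by (intro tdeg_le_mult homogeneous_imp_tdeg_le tdeg_le_cech_num) simp_all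
  then show "tdeg_le (int d + (int ((k + e) * Suc n) - int d - 1)) (f * q)"
    unfolding numerator by (simp add: algebra_simps)
qed

lemma power_CHAR_connecting_numerator:
  fixes f :: "'a::comm_ring_1 mpoly"
  assumes "prime CHAR('a)" and numerator: "X {0..n} ^ e * cech_num k g {0..n} = q * f"
  shows "X {0..n} ^ (CHAR('a) * e) * cech_num (CHAR('a) * k) (\<lambda>S. g S ^ CHAR('a)) {0..n}
    = (f ^ (CHAR('a) - 1) * q ^ CHAR('a)) * f"
proof -
  have "X {0..n} ^ (CHAR('a) * e) * cech_num (CHAR('a) * k) (\<lambda>S. g S ^ CHAR('a)) {0..n}
      = (X {0..n} ^ e * cech_num k g {0..n}) ^ CHAR('a)"
    unfolding cech_num_power_CHAR[OF assms(1)]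
    by (simp only: power_mult_distrib mult.commute[of "CHAR('a)" e] power_mult)
  also have "\<dots> = q ^ CHAR('a) * f ^ CHAR('a)" unfolding numerator by (rule power_mult_distrib)
  also have "f ^ CHAR('a) = f ^ (CHAR('a) - 1) * f"
    using prime_gt_0_nat[OF assms(1)] by (simp flip: power_minus_mult)
  finally show ?thesis by (simp add: mult_ac)
qed

lemma eventually_loc_zero_witness:
  assumes "loc_zero n f T a"
  shows "\<forall>\<^sub>F e in sequentially. \<exists>q. X T ^ e * a = q * f"
proof -
  obtain e q where multiple: "X T ^ e * a = q * f" using assms unfolding loc_zero_def by blast
  have "X T ^ e' * a = X T ^ (e' - e) * q * f" if "e' \<ge> e" for e'
  proof -
    have "X T ^ e' * a = X T ^ (e' - e) * (X T ^ e * a)"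
      using that by (simp flip: mult.assoc power_add)
    then show ?thesis by (simp add: multiple mult.assoc)
  qed
  then show ?thesis unfolding eventually_sequentially by blast
qed

lemma loc_zero_imp_cech_num_multiple:
  assumes "finite I" and loc_zero: "\<And>i. i \<in> I \<Longrightarrow> loc_zero n f (I - {i}) (w (I - {i}))"
  obtains E s where "s \<in> var_powers_ideal (m + E) I" "X I ^ E * cech_num m w I = f * s"
proof -
  have "\<forall>\<^sub>F E in sequentially. \<forall>S\<in>(\<lambda>i. I - {i}) ` I. \<exists>r. X S ^ E * w S = r * f"
    using assms by (intro eventually_ball_finite) (auto intro: eventually_loc_zero_witness)
  then obtain E where "\<forall>S\<in>(\<lambda>i. I - {i}) ` I. \<exists>r. X S ^ E * w S = r * f"
    using eventually_happens'[OF sequentially_bot] by blast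
  then obtain r where multiple: "\<And>i. i \<in> I \<Longrightarrow> X (I - {i}) ^ E * w (I - {i}) = r (I - {i}) * f"
    by (metis imageI)
  have "X I ^ E * cech_num m w I = cech_num (m + E) (\<lambda>S. w S * X S ^ E) I"
    using assms(1) by (simp add: cech_num_rescale)
  also have "\<dots> = cech_num (m + E) (\<lambda>S. f * r S) I"
    unfolding cech_num_eq_koszul using multiple by (intro koszul_cong) (simp add: mult.commute)
  also have "\<dots> = f * cech_num (m + E) r I" by (simp add: cech_num_eq_koszul koszul_mult)
  finally show ?thesis
    using that koszul_in_span[of "\<lambda>i. var i ^ (m + E)" r I] by (simp add: cech_num_eq_koszul)
qed

lemma cech_num_minus_coboundary:
  assumes "finite T" "k \<le> m"
  shows "cech_num m (\<lambda>S. g S * X S ^ (m - k) - cech_num m h S) T = X T ^ (m - k) * cech_num k g T"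
  using cech_num_rescale[OF assms(1), of k "m - k" g] assms
  by (simp add: cech_num_eq_koszul koszul_diff koszul_koszul)

lemma class_zero_n_imp_numerator_in_var_powers_ideal:
  fixes f :: "'a::idom mpoly"
  assumes "f \<noteq> 0" and numerator: "X {0..n} ^ e * cech_num k g {0..n} = q * f"
    and "class_zero_n n f k g"
  shows "q \<in> var_powers_ideal (k + e) {0..n}"
proof -
  let ?X = "X {0..n} :: 'a mpoly"
  obtain m h where "k \<le> m" and loc_zero: "\<And>i. i \<in> {0..n} \<Longrightarrow>
      loc_zero n f (Sn n i) (g (Sn n i) * X (Sn n i) ^ (m - k) - cech_num m h (Sn n i))"
    using assms(3) unfolding class_zero_n_def by auto
  obtain E s where s_in_ideal: "s \<in> var_powers_ideal (m + E) {0..n}"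
    and "?X ^ E * cech_num m (\<lambda>S. g S * X S ^ (m - k) - cech_num m h S) {0..n} = f * s"
    using loc_zero_imp_cech_num_multiple[OF _ loc_zero] by blast
  then have "f * (?X ^ e * s) = ?X ^ (E + (m - k)) * (?X ^ e * cech_num k g {0..n})"
    unfolding cech_num_minus_coboundary[OF finite_atLeastAtMost \<open>k \<le> m\<close>]
    by (simp add: power_add mult_ac)
  also have "\<dots> = f * (?X ^ (E + (m - k)) * q)"
    unfolding numerator by (simp only: mult_ac)
  finally have "?X ^ e * s = ?X ^ (E + (m - k)) * q" using \<open>f \<noteq> 0\<close> by simp
  moreover have "?X ^ e * s \<in> var_powers_ideal (m + E + e) {0..n}"
    using s_in_ideal by (simp add: X_power_mult_in_var_powers_ideal_iff)
  moreover have "m + E + e = k + e + (E + (m - k))" using \<open>k \<le> m\<close> by simp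
  ultimately have "?X ^ (E + (m - k)) * q \<in> var_powers_ideal (k + e + (E + (m - k))) {0..n}"
    by simp
  then show ?thesis by (simp only: X_power_mult_in_var_powers_ideal_iff finite_atLeastAtMost)
qed

lemma restrict_R_cech_num:
  assumes "T \<subseteq> {0..n}"
  shows "restrict_R n (cech_num k g T) = cech_num k (\<lambda>S. restrict_R n (g S)) T"
  unfolding restrict_R_def cech_num_eq_koszul
proof (rule filter_keys_koszul)
  fix i t m assume "i \<in> T" "t \<in> Poly_Mapping.keys (var i ^ k :: 'a mpoly)"
  moreover from this have "in_R n (var i ^ k :: 'a mpoly)"
    using assms by (intro in_R_power in_R_var) auto
  ultimately have "Poly_Mapping.keys t \<subseteq> {0..n}" by (simp add: in_R_def)
  then show "Poly_Mapping.keys (t + m) \<subseteq> {0..n} \<longleftrightarrow> Poly_Mapping.keys m \<subseteq> {0..n}"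
    by (simp add: keys_add_nat)
qed

lemma in_var_powers_ideal_imp_cech_num:
  assumes "in_R n q" "q \<in> var_powers_ideal k {0..n}"
  obtains b where "\<And>S. in_R n (b S)" "q = cech_num k b {0..n}"
proof -
  obtain b where "q = cech_num k b {0..n}"
    using assms(2) by (auto simp: in_span_image_iff_koszul cech_num_eq_koszul)
  then have "q = cech_num k (\<lambda>S. restrict_R n (b S)) {0..n}"
    using assms(1) by (simp add: restrict_R_id flip: restrict_R_cech_num)
  then show ?thesis using that[of "\<lambda>S. restrict_R n (b S)"] by simp
qed

lemma cech_num_eq_zero_imp_coboundary:
  assumes in_R: "\<And>i. i \<le> n \<Longrightarrow> in_R n (c (Sn n i))" and "cech_num k c {0..n} = 0"
  obtains h where "\<And>S. in_R n (h S)" "\<And>i. i \<le> n \<Longrightarrow> c (Sn n i) = cech_num k h (Sn n i)"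
proof -
  have "koszul_cocycle (\<lambda>i. var i ^ k) {0..n} n c"
    using assms(2) card_subset_eq[of "{0..n}"] by (auto simp: koszul_cocycle_def cech_num_eq_koszul)
  moreover have "koszul_exact (\<lambda>i. var i ^ k :: 'a mpoly) {0..n} n"
    using koszul_exact_below_var_powers[of "{0..n}" "\<lambda>i. i" "\<lambda>i. var i ^ k :: 'a mpoly" k]
    by (simp add: koszul_exact_below_def)
  ultimately obtain h where coboundary: "\<And>T. T \<subseteq> {0..n} \<Longrightarrow> card T = n \<Longrightarrow> c T = cech_num k h T"
    by (auto simp: koszul_exact_def koszul_coboundary_def cech_num_eq_koszul)
  have "c (Sn n i) = cech_num k (\<lambda>S. restrict_R n (h S)) (Sn n i)" if "i \<le> n" for i
    using coboundary[of "Sn n i"] restrict_R_id[OF in_R[OF that]] that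
    by (simp flip: restrict_R_cech_num)
  then show ?thesis using that[of "\<lambda>S. restrict_R n (h S)"] by simp
qed

lemma numerator_in_var_powers_ideal_imp_class_zero_n:
  fixes f :: "'a::comm_ring_1 mpoly"
  assumes "in_R n f" "in_R n q" and g: "cochain_n n k g"
    and numerator: "X {0..n} ^ e * cech_num k g {0..n} = q * f"
    and pow: "q \<in> var_powers_ideal (k + e) {0..n}"
  shows "class_zero_n n f k g"
proof -
  obtain b where b_in_R: "\<And>S. in_R n (b S)" and q_eq: "q = cech_num (k + e) b {0..n}"
    using assms(2) pow by (rule in_var_powers_ideal_imp_cech_num) blast
  define c where "c = (\<lambda>S. g S * X S ^ e - f * b S)"
  have "in_R n (c (Sn n i))" if "i \<le> n" for i
    unfolding c_def using that assms(1) g b_in_R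
    by (auto simp: cochain_n_def intro!: in_R_diff in_R_mult in_R_power in_R_X)
  moreover have "cech_num (k + e) c {0..n} = X {0..n} ^ e * cech_num k g {0..n} - f * q"
    using cech_num_rescale[of "{0..n}" k e g]
    by (simp add: c_def q_eq cech_num_eq_koszul koszul_diff koszul_mult)
  then have "cech_num (k + e) c {0..n} = 0" unfolding numerator by (simp add: mult.commute)
  ultimately obtain h where h_in_R: "\<And>S. in_R n (h S)"
    and c_eq: "\<And>i. i \<le> n \<Longrightarrow> c (Sn n i) = cech_num (k + e) h (Sn n i)"
    by (rule cech_num_eq_zero_imp_coboundary) blast+
  have "loc_zero n f (Sn n i) (g (Sn n i) * X (Sn n i) ^ (k + e - k) - cech_num (k + e) h (Sn n i))"
    if "i \<le> n" for i
    unfolding loc_zero_def c_eq[OF that, symmetric] using b_in_R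
    by (intro exI[of _ 0] exI[of _ "b (Sn n i)"]) (simp add: c_def mult.commute)
  with h_in_R show ?thesis unfolding class_zero_n_def by (metis le_add1)
qed

theorem theorem3p5:
  fixes f :: "'a::field mpoly" and n d p :: nat
  assumes char: "CHAR('a) = p" and ppos: "p > 0"
    and fR: "in_R n f" and hom: "homogeneous d f"
    and jac: "jacobian_m_primary n f"
    and pbound: "int p \<ge> int n * int d - int d - int n"
  shows "\<forall>k g. cochain_n n k g \<and> cocycle_n n f k g \<and> negative_n n k g \<and>
                class_zero_n n f (p * k) (\<lambda>S. g S ^ p)
             \<longrightarrow> class_zero_n n f k g"
proof (intro allI impI, elim conjE)
  fix k and g :: "nat set \<Rightarrow> 'a mpoly"
  assume g: "cochain_n n k g" "cocycle_n n f k g" "negative_n n k g"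
    and zero: "class_zero_n n f (p * k) (\<lambda>S. g S ^ p)"
  have prime: "prime p" using char ppos prime_CHAR_semidom[where 'a = 'a] by simp
  obtain j where "pd j f \<noteq> 0" using jacobian_m_primary_pd_nonzero[OF jac] by blast
  then have "f \<noteq> 0" "d > 0" using hom by (auto intro: pd_nonzero_imp_degree_pos)
  obtain e q where "in_R n q" and numerator: "X {0..n} ^ e * cech_num k g {0..n} = q * f"
    using g(2) unfolding cocycle_n_def loc_zero_def by blast
  have deg: "tdeg_le (int ((k + e) * Suc n) - int d - 1) q"
    using hom \<open>f \<noteq> 0\<close> g(3) numerator by (rule tdeg_le_connecting_numerator)
  have "X {0..n} ^ (p * e) * cech_num (p * k) (\<lambda>S. g S ^ p) {0..n} = (f ^ (p - 1) * q ^ p) * f"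
    using power_CHAR_connecting_numerator[OF _ numerator] prime char by blast
  then have "f ^ (p - 1) * q ^ p \<in> var_powers_ideal (p * (k + e)) {0..n}"
    using class_zero_n_imp_numerator_in_var_powers_ideal[OF \<open>f \<noteq> 0\<close> _ zero]
    by (simp add: distrib_left)
  with deg have "q \<in> var_powers_ideal (k + e) {0..n}"
    by (rule frobenius_injective_on_numerators[OF char prime \<open>d > 0\<close> hom jac pbound])
  with fR \<open>in_R n q\<close> g(1) numerator show "class_zero_n n f k g"
    by (rule numerator_in_var_powers_ideal_imp_class_zero_n)
qed

end
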